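(* Let $R=\mathbb{C}[[x,y]]$ and $\mathfrak{m}=(x,y)$. Then there is a sequence $\{\mathfrak{a}_{\bullet,k}\}_{k\geq 1}$ in $\mathrm{Fil}^s_{R,\mathfrak{m}}$ which is decreasing (that is, $(\mathfrak{a}_{\bullet,k+1})_\lambda\subseteq(\mathfrak{a}_{\bullet,k})_\lambda$ for all $k\geq 1$ and all $\lambda>0$), whose termwise intersection $\mathfrak{a}_\bullet=\bigcap_{k\geq 1}\mathfrak{a}_{\bullet,k}$, i.e. $\mathfrak{a}_\lambda=\bigcap_{k\ge 1}(\mathfrak{a}_{\bullet,k})_\lambda$, lies in $\mathrm{Fil}^s_{R,\mathfrak{m}}$, and such that $$d_1(\mathfrak{a}_\bullet,\mathfrak{a}_{\bullet,k})\longrightarrow \tfrac12\neq 0\qquad (k\to\infty).$$ In particular, monotone convergence fails for $(\mathrm{Fil}^s_{R,\mathfrak{m}},d_1)$: a decreasing sequence in $\mathrm{Fil}^s_{R,\mathfrak{m}}$ whose termwise intersection lies in $\mathrm{Fil}^s_{R,\mathfrak{m}}$ need not converge to that intersection in $d_1$.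
   Context: Let $(R,\mathfrak{m})$ be a Noetherian local domain of dimension $n$ (here $n=2$). An $\mathfrak{m}$-filtration is a decreasing family $\mathfrak{a}_\bullet=(\mathfrak{a}_\lambda)_{\lambda\in\mathbb{R}_{>0}}$ of $\mathfrak{m}$-primary ideals of $R$, together with $\mathfrak{a}_0:=R$, satisfying $\mathfrak{a}_\lambda\mathfrak{a}_\mu\subseteq\mathfrak{a}_{\lambda+\mu}$ and $\mathfrak{a}_\lambda=\bigcap_{\mu<\lambda}\mathfrak{a}_\mu$ for $\lambda>0$. Inclusions and intersections of filtrations are taken termwise. It is linearly bounded if there is $\alpha>0$ with $\mathfrak{a}_\lambda\subseteq\mathfrak{m}^{\lceil\alpha\lambda\rceil}$ for all $\lambda>0$. Its (normalized) multiplicity is $e(\mathfrak{a}_\bullet)=\lim_{m\to\infty}\frac{\ell(R/\mathfrak{a}_m)}{m^n/n!}$ ($m\in\mathbb{Z}_{>0}$, $\ell$ = length), a limit known to exist for linearly bounded filtrations. $\mathrm{Fil}_{R,\mathfrak{m}}$ denotes the set of linearly bounded $\mathfrak{m}$-filtrations (equivalently, those of positive multiplicity). A (real) valuation $v$ on $\mathrm{Frac}(R)$, with $v(0)=+\infty$, is centered at $\mathfrak{m}$ if $v\ge 0$ on $R$ and $\{f\in R: v(f)>0\}=\mathfrak{m}$. Its valuation filtration is $\mathfrak{a}_\lambda(v)=\{f\in R: v(f)\geq\lambda\}$; $v$ has positive volume if $e(\mathfrak{a}_\bullet(v))>0$. A filtration in $\mathrm{Fil}_{R,\mathfrak{m}}$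 is saturated if it is the intersection of a nonempty family of valuation filtrations $\mathfrak{a}_\bullet(v)$ with $v$ centered at $\mathfrak{m}$ of positive volume. $\mathrm{Fil}^s_{R,\mathfrak{m}}\subseteq\mathrm{Fil}_{R,\mathfrak{m}}$ is the subset of saturated filtrations. For $\mathfrak{a}_\bullet,\mathfrak{b}_\bullet\in\mathrm{Fil}_{R,\mathfrak{m}}$, $d_1(\mathfrak{a}_\bullet,\mathfrak{b}_\bullet)=2e(\mathfrak{a}_\bullet\cap\mathfrak{b}_\bullet)-e(\mathfrak{a}_\bullet)-e(\mathfrak{b}_\bullet)$. It is known to be a pseudometric on $\mathrm{Fil}_{R,\mathfrak{m}}$ that restricts to a metric on $\mathrm{Fil}^s_{R,\mathfrak{m}}$. *)

theory Defs
  imports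
    Complex_Main
    "HOL-Library.Extended_Real"
    "HOL-Computational_Algebra.Formal_Power_Series"
    "HOL-Computational_Algebra.Fraction_Field"
    "HOL-Algebra.Module"
    "HOL-Algebra.QuotRing"
    "HOL-Algebra.Ideal_Product"
    "HOL-Algebra.Algebraic_Closure_Type"
begin

definition radical :: "('a, 'b) ring_scheme \<Rightarrow> 'a set \<Rightarrow> 'a set" where
  "radical R I = {f \<in> carrier R. \<exists>k::nat. f [^]\<^bsub>R\<^esub> k \<in> I}"

definition primary_ideal :: "('a, 'b) ring_scheme \<Rightarrow> 'a set \<Rightarrow> bool" where
  "primary_ideal R Q \<longleftrightarrow> ideal Q R \<and> Q \<noteq> carrier R \<and>
     (\<forall>f\<in>carrier R. \<forall>g\<in>carrier R. f \<otimes>\<^bsub>R\<^esub> g \<in> Q \<longrightarrow> f \<in> Q \<or> g \<in> radical R Q)"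

definition primary_to :: "('a, 'b) ring_scheme \<Rightarrow> 'a set \<Rightarrow> 'a set \<Rightarrow> bool" where
  "primary_to R \<mm> Q \<longleftrightarrow> primary_ideal R Q \<and> radical R Q = \<mm>"

text \<open>The quotient \<open>R/I\<close> as an \<open>R\<close>-module.\<close>

definition quot_module :: "('a, 'b) ring_scheme \<Rightarrow> 'a set \<Rightarrow> ('a, 'a set) module" where
  "quot_module R I =
     \<lparr>carrier = carrier (R Quot I), monoid.mult = monoid.mult (R Quot I), one = one (R Quot I),
      ring.zero = ring.zero (R Quot I), add = add (R Quot I),
      module.smult = (\<lambda>r c. (I +>\<^bsub>R\<^esub> r) \<otimes>\<^bsub>R Quot I\<^esub> c)\<rparr>"

text \<open>The length of a module is the supremum of the lengths \<open>n\<close> of strict chains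
  \<open>N\<^sub>0 \<subset> N\<^sub>1 \<subset> \<dots> \<subset> N\<^sub>n\<close> of submodules.\<close>

definition module_length ::
    "('a, 'b) ring_scheme \<Rightarrow> ('a, 'c, 'd) module_scheme \<Rightarrow> enat" where
  "module_length R M = Sup {enat n | n. \<exists>N :: nat \<Rightarrow> 'c set.
     (\<forall>i\<le>n. submodule (N i) R M) \<and> (\<forall>i<n. N i \<subset> N (Suc i))}"

text \<open>A filtration is a function on the reals of which only the values at \<open>s \<ge> 0\<close> matter.\<close>

type_synonym 'a filtration = "real \<Rightarrow> 'a set"

definition m_filtration :: "('a, 'b) ring_scheme \<Rightarrow> 'a set \<Rightarrow> 'a filtration \<Rightarrow> bool" where
  "m_filtration R \<mm> \<aa> \<longleftrightarrow>
     \<aa> 0 = carrier R \<and>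
     (\<forall>s>0. primary_to R \<mm> (\<aa> s)) \<and>
     (\<forall>s\<ge>0. \<forall>t\<ge>s. \<aa> t \<subseteq> \<aa> s) \<and>
     (\<forall>s\<ge>0. \<forall>t\<ge>0. \<aa> s \<cdot>\<^bsub>R\<^esub> \<aa> t \<subseteq> \<aa> (s + t)) \<and>
     (\<forall>s>0. \<aa> s = (\<Inter>t\<in>{0..<s}. \<aa> t))"

definition linearly_bounded :: "('a, 'b) ring_scheme \<Rightarrow> 'a set \<Rightarrow> 'a filtration \<Rightarrow> bool" where
  "linearly_bounded R \<mm> \<aa> \<longleftrightarrow>
     (\<exists>\<alpha>>0. \<forall>s>0. \<aa> s \<subseteq> \<mm> [^]\<^bsub>ideals_set R\<^esub> nat \<lceil>\<alpha> * s\<rceil>)"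

definition Fil :: "('a, 'b) ring_scheme \<Rightarrow> 'a set \<Rightarrow> 'a filtration set" where
  "Fil R \<mm> = {\<aa>. m_filtration R \<mm> \<aa> \<and> linearly_bounded R \<mm> \<aa>}"

text \<open>Here \<open>n\<close> is the dimension of the Noetherian local domain \<open>R\<close>.  The lengths involved are
  finite since the ideals \<open>\<aa> m\<close> with \<open>m > 0\<close> are primary to the maximal ideal.\<close>

definition multiplicity_fil :: "nat \<Rightarrow> ('a, 'b) ring_scheme \<Rightarrow> 'a filtration \<Rightarrow> real" where
  "multiplicity_fil n R \<aa> =
     lim (\<lambda>m::nat. real (the_enat (module_length R (quot_module R (\<aa> (real m))))) /
                   (real m ^ n / fact n))"

definition inter_fil :: "'a filtration \<Rightarrow> 'a filtration \<Rightarrow> 'a filtration" where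
  "inter_fil \<aa> \<bb> = (\<lambda>s. \<aa> s \<inter> \<bb> s)"

definition Inter_fil :: "'i set \<Rightarrow> ('i \<Rightarrow> 'a filtration) \<Rightarrow> 'a filtration" where
  "Inter_fil I \<aa> = (\<lambda>s. \<Inter>i\<in>I. \<aa> i s)"

definition d1 :: "nat \<Rightarrow> ('a, 'b) ring_scheme \<Rightarrow> 'a filtration \<Rightarrow> 'a filtration \<Rightarrow> real" where
  "d1 n R \<aa> \<bb> = 2 * multiplicity_fil n R (inter_fil \<aa> \<bb>)
                 - multiplicity_fil n R \<aa> - multiplicity_fil n R \<bb>"

definition real_valuation :: "('k::field \<Rightarrow> ereal) \<Rightarrow> bool" where
  "real_valuation v \<longleftrightarrow>
     v 0 = \<infinity> \<and>
     (\<forall>f. f \<noteq> 0 \<longrightarrow> \<bar>v f\<bar> \<noteq> \<infinity>) \<and>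
     (\<forall>f g. v (f * g) = v f + v g) \<and>
     (\<forall>f g. v (f + g) \<ge> min (v f) (v g))"

text \<open>From here on the ring is a type \<open>'a\<close> of class \<open>idom\<close>, regarded as the ring
  \<^const>\<open>ring_of_type_algebra\<close>, with fraction field \<open>'a fract\<close>;
  \<open>f\<close> in the ring is identified with \<open>Fract f 1\<close>.\<close>

definition centered_at :: "'a::idom set \<Rightarrow> ('a fract \<Rightarrow> ereal) \<Rightarrow> bool" where
  "centered_at \<mm> v \<longleftrightarrow> (\<forall>f. v (Fract f 1) \<ge> 0) \<and> {f. v (Fract f 1) > 0} = \<mm>"

definition valuation_fil :: "('a::idom fract \<Rightarrow> ereal) \<Rightarrow> 'a filtration" where
  "valuation_fil v = (\<lambda>s. {f. v (Fract f 1) \<ge> ereal s})"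

definition positive_volume :: "nat \<Rightarrow> ('a::idom fract \<Rightarrow> ereal) \<Rightarrow> bool" where
  "positive_volume n v \<longleftrightarrow> multiplicity_fil n ring_of_type_algebra (valuation_fil v) > 0"

definition saturated :: "nat \<Rightarrow> 'a::idom set \<Rightarrow> 'a filtration \<Rightarrow> bool" where
  "saturated n \<mm> \<aa> \<longleftrightarrow> (\<exists>V :: ('a fract \<Rightarrow> ereal) set.
     V \<noteq> {} \<and>
     (\<forall>v\<in>V. real_valuation v \<and> centered_at \<mm> v \<and> positive_volume n v) \<and>
     (\<forall>s\<ge>0. \<aa> s = Inter_fil V valuation_fil s))"

definition Fil_sat :: "nat \<Rightarrow> 'a::idom set \<Rightarrow> 'a filtration set" where
  "Fil_sat n \<mm> = {\<aa> \<in> Fil ring_of_type_algebra \<mm>. saturated n \<mm> \<aa>}"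

text \<open>\<open>\<complex>[[x,y]]\<close> is realised as \<open>\<complex>[[x]][[y]]\<close>.\<close>

type_synonym cxy = "complex fps fps"

abbreviation Rxy :: "cxy ring" where
  "Rxy \<equiv> ring_of_type_algebra"

definition x_var :: cxy where "x_var = fps_const fps_X"
definition y_var :: cxy where "y_var = fps_X"

definition mxy :: "cxy set" where
  "mxy = Idl\<^bsub>Rxy\<^esub> {x_var, y_var}"

text \<open>A decreasing sequence, indexed by \<open>k \<ge> 1\<close>, of saturated filtrations of \<open>\<complex>[[x,y]]\<close> whose
  termwise intersection is saturated.\<close>

definition decreasing_sat_seq :: "(nat \<Rightarrow> cxy filtration) \<Rightarrow> bool" where
  "decreasing_sat_seq \<aa> \<longleftrightarrow>
     (\<forall>k\<ge>1. \<aa> k \<in> Fil_sat 2 mxy) \<and>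
     (\<forall>k\<ge>1. \<forall>s>0. \<aa> (Suc k) s \<subseteq> \<aa> k s) \<and>
     Inter_fil {1..} \<aa> \<in> Fil_sat 2 mxy"

end

theory Submission
  imports Defs "HOL-Computational_Algebra.Fundamental_Theorem_Algebra"
begin

text \<open>
  For \<open>i \<ge> 1\<close> let \<open>v\<^sub>i\<close> be the monomial valuation with \<open>v\<^sub>i(x) = 1\<close> and \<open>v\<^sub>i(y - i x) = 1 + 2\<^sup>i\<close>,
  and let the \<open>k\<close>-th filtration be the intersection of the valuation filtrations of
  \<open>v\<^sub>1, \<dots>, v\<^sub>k\<close>.  A power series belongs to its \<open>m\<close>-th ideal iff, for all \<open>d < m\<close> and
  \<open>i \<le> k\<close>, its homogeneous part of degree \<open>d\<close> is divisible by \<open>(y - i x)\<close> to the power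
  \<open>\<lceil>(m - d) / 2\<^sup>i\<rceil>\<close>.  Hence the colength is
  \<open>\<Sum>d<m. min (d + 1) (\<Sum>i\<le>k. \<lceil>(m - d) / 2\<^sup>i\<rceil>)\<close>, which yields the multiplicity \<open>s / (1 + s)\<close> with
  \<open>s = \<Sum>i\<le>k. 2\<^sup>-\<^sup>i = 1 - 2\<^sup>-\<^sup>k\<close>, tending to \<open>1/2\<close>.  In the intersection over all \<open>k\<close>, a homogeneous
  part of degree \<open>d < m\<close> has infinitely many linear factors and thus vanishes: the
  intersection is the \<open>\<mm>\<close>-adic filtration, whose multiplicity is \<open>1\<close>.
\<close>

section \<open>Length via composition series\<close>

abbreviation (input) Rt :: "'a::comm_ring_1 ring" where "Rt \<equiv> ring_of_type_algebra"

section \<open>Ideals and cosets in the ring carried by a type\<close>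

lemma ring_of_type_algebra_simps [simp]:
  "carrier (Rt :: 'a::comm_ring_1 ring) = UNIV"
  "x \<otimes>\<^bsub>Rt\<^esub> y = x * y" "x \<oplus>\<^bsub>Rt\<^esub> y = x + y" "\<one>\<^bsub>Rt\<^esub> = 1" "\<zero>\<^bsub>Rt\<^esub> = 0"
  by (simp_all add: ring_of_type_algebra_def)

lemma nat_pow_ring_of_type_algebra [simp]: "(x::'a::comm_ring_1) [^]\<^bsub>Rt\<^esub> (k::nat) = x ^ k"
  by (induction k) (simp_all add: nat_pow_def mult.commute)

lemma a_inv_ring_of_type_algebra [simp]: "\<ominus>\<^bsub>Rt\<^esub> (x::'a::comm_ring_1) = - x"
proof -
  interpret ring "Rt :: 'a ring" by (rule ring_from_type_algebra)
  show ?thesis using minus_equality[of "- x" x] by simp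
qed

lemma ideal_iff:
  fixes I :: "'a::comm_ring_1 set"
  shows "ideal I Rt \<longleftrightarrow> 0 \<in> I \<and> (\<forall>a\<in>I. \<forall>b\<in>I. a + b \<in> I) \<and> (\<forall>r. \<forall>a\<in>I. r * a \<in> I)" (is "_ \<longleftrightarrow> ?P")
proof
  assume "ideal I Rt"
  then interpret ideal I Rt .
  show ?P
    using additive_subgroup.zero_closed[OF is_additive_subgroup]
      additive_subgroup.a_closed[OF is_additive_subgroup] I_l_closed by simp
next
  interpret R: ring "Rt :: 'a ring" by (rule ring_from_type_algebra)
  assume P: ?P
  show "ideal I Rt"
  proof (rule idealI)
    show "ring (Rt :: 'a ring)" by (rule R.ring_axioms)
    show "subgroup I (add_monoid Rt)"
    proof (rule R.add.subgroupI)
      show "I \<noteq> {}" using P by blast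
      fix a assume "a \<in> I"
      then have "(-1) * a \<in> I" using P by blast
      then show "\<ominus>\<^bsub>Rt\<^esub> a \<in> I" by simp
    qed (use P in auto)
    fix a x assume "a \<in> I"
    then show "x \<otimes>\<^bsub>Rt\<^esub> a \<in> I" "a \<otimes>\<^bsub>Rt\<^esub> x \<in> I" using P by (simp_all add: mult.commute[of a])
  qed
qed

lemma ideal_diff:
  fixes I :: "'a::comm_ring_1 set"
  assumes "ideal I Rt" "a \<in> I" "b \<in> I" shows "a - b \<in> I"
proof -
  have "(-1) * b \<in> I" using assms unfolding ideal_iff by blast
  then have "a + (-1) * b \<in> I" using assms unfolding ideal_iff by blast
  then show ?thesis by simp
qed

lemma coset_eq_iff:
  fixes I :: "'a::comm_ring_1 set"
  assumes "ideal I Rt"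
  shows "I +>\<^bsub>Rt\<^esub> a = I +>\<^bsub>Rt\<^esub> b \<longleftrightarrow> a - b \<in> I"
proof -
  interpret ideal I Rt by fact
  show ?thesis
    using quotient_eq_iff_same_a_r_cos[OF assms, of a b] by (simp add: a_minus_def)
qed

lemma coset_zero: "I +>\<^bsub>Rt\<^esub> (0::'a::comm_ring_1) = I"
  by (simp add: a_r_coset_def r_coset_def)

lemma carrier_Quot: "carrier (Rt Quot I) = range (\<lambda>a::'a::comm_ring_1. I +>\<^bsub>Rt\<^esub> a)"
  by (auto simp: FactRing_def A_RCOSETS_def')

text \<open>One half of the correspondence between submodules of R/I and ideals containing I; it
  pulls arbitrary chains of submodules back to chains of ideals.\<close>

lemma submodule_quot_module_preimage:
  fixes I :: "'a::comm_ring_1 set"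
  assumes I: "ideal I Rt" and N: "submodule N Rt (quot_module Rt I)"
  shows "ideal {f. I +>\<^bsub>Rt\<^esub> f \<in> N} Rt" "I \<subseteq> {f. I +>\<^bsub>Rt\<^esub> f \<in> N}"
proof -
  interpret I: ideal I Rt by fact
  interpret N: submodule N Rt "quot_module Rt I" by fact
  have 0: "I \<in> N" using N.one_closed by (simp add: quot_module_def FactRing_def)
  have I0: "I +>\<^bsub>Rt\<^esub> f = I" if "f \<in> I" for f
    using that coset_eq_iff[OF I, of f 0] by (simp add: coset_zero)
  show "I \<subseteq> {f. I +>\<^bsub>Rt\<^esub> f \<in> N}" using 0 I0 by auto
  have add: "I +>\<^bsub>Rt\<^esub> (a + b) \<in> N" if "I +>\<^bsub>Rt\<^esub> a \<in> N" "I +>\<^bsub>Rt\<^esub> b \<in> N" for a b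
    using N.m_closed[OF that] I.a_rcos_sum[of a b] by (simp add: quot_module_def FactRing_def)
  have sm: "I +>\<^bsub>Rt\<^esub> (r * a) \<in> N" if "I +>\<^bsub>Rt\<^esub> a \<in> N" for r a
    using N.smult_closed[OF _ that, of r] I.rcoset_mult_add[of r a]
    by (simp add: quot_module_def FactRing_def)
  show "ideal {f. I +>\<^bsub>Rt\<^esub> f \<in> N} Rt"
    unfolding ideal_iff using 0 I0[of 0] add sm I by (auto simp: ideal_iff)
qed

text \<open>The other half of the correspondence; it pushes a composition series of ideals down to
  R/I.\<close>

lemma submodule_quot_module_image:
  fixes I :: "'a::comm_ring_1 set"
  assumes I: "ideal I Rt" and J: "ideal J Rt" and IJ: "I \<subseteq> J"
  shows "submodule ((\<lambda>f. I +>\<^bsub>Rt\<^esub> f) ` J) Rt (quot_module Rt I)"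
proof -
  interpret I: ideal I Rt by fact
  interpret Q: ring "Rt Quot I" by (rule I.quotient_is_ring)
  \<comment> \<open>The quotient ring and the quotient module are records of different types;
    inversion depends only on the additive structure, which they share.\<close>
  have inv: "inv\<^bsub>add_monoid (quot_module Rt I)\<^esub> a = inv\<^bsub>add_monoid (Rt Quot I)\<^esub> a" for a
    by (simp add: quot_module_def m_inv_def)
  have add: "(I +>\<^bsub>Rt\<^esub> a) \<oplus>\<^bsub>Rt Quot I\<^esub> (I +>\<^bsub>Rt\<^esub> b) = I +>\<^bsub>Rt\<^esub> (a + b)" for a b
    using I.a_rcos_sum[of a b] by (simp add: FactRing_def)
  have mlt: "(I +>\<^bsub>Rt\<^esub> a) \<otimes>\<^bsub>Rt Quot I\<^esub> (I +>\<^bsub>Rt\<^esub> b) = I +>\<^bsub>Rt\<^esub> (a * b)" for a b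
    using I.rcoset_mult_add[of a b] by (simp add: FactRing_def)
  have zero: "I +>\<^bsub>Rt\<^esub> 0 = \<zero>\<^bsub>Rt Quot I\<^esub>"
    by (simp add: FactRing_def coset_zero)
  have "subgroup ((\<lambda>f. I +>\<^bsub>Rt\<^esub> f) ` J) (add_monoid (Rt Quot I))"
  proof (rule Q.add.subgroupI)
    show "(\<lambda>f. I +>\<^bsub>Rt\<^esub> f) ` J \<subseteq> carrier (Rt Quot I)"
      by (auto simp: carrier_Quot)
    show "(\<lambda>f. I +>\<^bsub>Rt\<^esub> f) ` J \<noteq> {}" using J by (auto simp: ideal_iff)
    fix a assume "a \<in> (\<lambda>f. I +>\<^bsub>Rt\<^esub> f) ` J"
    then obtain f where f: "f \<in> J" "a = I +>\<^bsub>Rt\<^esub> f" by auto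
    have "- f \<in> J" using ideal_diff[OF J, of 0 f] f J by (simp add: ideal_iff)
    moreover have "\<ominus>\<^bsub>Rt Quot I\<^esub> a = I +>\<^bsub>Rt\<^esub> (- f)"
      by (rule Q.minus_equality) (auto simp: f add zero carrier_Quot)
    ultimately show "\<ominus>\<^bsub>Rt Quot I\<^esub> a \<in> (\<lambda>f. I +>\<^bsub>Rt\<^esub> f) ` J"
      by simp
  next
    fix a b assume "a \<in> (\<lambda>f. I +>\<^bsub>Rt\<^esub> f) ` J" "b \<in> (\<lambda>f. I +>\<^bsub>Rt\<^esub> f) ` J"
    then show "a \<oplus>\<^bsub>Rt Quot I\<^esub> b \<in> (\<lambda>f. I +>\<^bsub>Rt\<^esub> f) ` J"
      using J by (auto simp: add ideal_iff)
  qed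
  then have "subgroup ((\<lambda>f. I +>\<^bsub>Rt\<^esub> f) ` J) (add_monoid (quot_module Rt I))"
    unfolding subgroup_def inv by (simp add: quot_module_def)
  moreover have "submodule_axioms ((\<lambda>f. I +>\<^bsub>Rt\<^esub> f) ` J) Rt (quot_module Rt I)"
    using J by unfold_locales (auto simp: quot_module_def mlt ideal_iff)
  ultimately show ?thesis
    by (rule submodule.intro)
qed

text \<open>\<open>covers I J\<close> says that \<open>J/I\<close> is a simple module.\<close>

definition covers :: "'a::comm_ring_1 set \<Rightarrow> 'a set \<Rightarrow> bool" where
  "covers I J \<longleftrightarrow> ideal I Rt \<and> ideal J Rt \<and> I \<subset> J \<and> (\<forall>f\<in>J. \<forall>g\<in>J - I. \<exists>c. f - c * g \<in> I)"

text \<open>A direct substitute for the Jordan-Hoelder theorem. Each ideal is assigned the set of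
  layers of the series \<open>W\<close> that it meets nontrivially. Strictly larger ideals meet
  strictly more layers, and there are only \<open>D\<close> of them.\<close>

lemma strict_chain_le_composition_length:
  fixes W J :: "nat \<Rightarrow> 'a::comm_ring_1 set"
  assumes W: "\<And>j. j < D \<Longrightarrow> covers (W j) (W (Suc j))" and WD: "W D = UNIV"
    and J: "\<And>i. i \<le> n \<Longrightarrow> ideal (J i) Rt" "\<And>i. i \<le> n \<Longrightarrow> W 0 \<subseteq> J i"
    and strict: "\<And>i. i < n \<Longrightarrow> J i \<subset> J (Suc i)"
  shows "n \<le> D"
proof -
  define S where "S K = {j. j < D \<and> \<not> K \<inter> W (Suc j) \<subseteq> W j}" for K :: "'a set"
  have fin: "finite (S K)" and cardS: "card (S K) \<le> D" for K
  proof -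
    have "S K \<subseteq> {..<D}" by (auto simp: S_def)
    then show "finite (S K)" "card (S K) \<le> D"
      using finite_subset card_mono[of "{..<D}" "S K"] by auto
  qed
  have strictS: "S K \<subset> S L"
    if K: "ideal K Rt" and L: "ideal L Rt" and W0: "W 0 \<subseteq> K" and KL: "K \<subset> L" for K L
  proof -
    have sub: "S K \<subseteq> S L" using KL by (auto simp: S_def)
    moreover have "S K \<noteq> S L"
    proof
      assume eq: "S K = S L"
      \<comment> \<open>If both ideals meet the same layers, climbing the series shows that
        \<open>L\<close> is contained in \<open>K\<close>.\<close>
      have "L \<inter> W j \<subseteq> K" if "j \<le> D" for j
        using that
      proof (induction j)
        case 0 then show ?case using W0 by auto
      next
        case (Suc j)
        have cov: "covers (W j) (W (Suc j))" using Suc W by simp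
        show ?case
        proof
          fix f assume f: "f \<in> L \<inter> W (Suc j)"
          show "f \<in> K"
          proof (cases "f \<in> W j")
            case True then show ?thesis using Suc f by auto
          next
            case False
            then have "j \<in> S L" using f Suc.prems by (auto simp: S_def)
            then obtain g where g: "g \<in> K" "g \<in> W (Suc j)" "g \<notin> W j"
              unfolding eq[symmetric] by (auto simp: S_def)
            \<comment> \<open>The layer is simple and \<open>g\<close> is nonzero in it, so a
              multiple of \<open>g\<close> moves \<open>f\<close> one level down, into the range of
              the induction hypothesis.\<close>
            then obtain c where c: "f - c * g \<in> W j"
              using cov f unfolding covers_def by blast
            have cg: "c * g \<in> K" using g K by (simp add: ideal_iff)
            then have "f - c * g \<in> L" using f KL by (intro ideal_diff[OF L]) auto
            then have "f - c * g \<in> K" using c Suc by auto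
            then have "(f - c * g) + c * g \<in> K" using cg K unfolding ideal_iff by blast
            then show ?thesis by simp
          qed
        qed
      qed
      from this[of D] show False using WD KL by auto
    qed
    ultimately show ?thesis by blast
  qed
  have "i \<le> card (S (J i))" if "i \<le> n" for i
    using that
  proof (induction i)
    case (Suc i)
    have "S (J i) \<subset> S (J (Suc i))"
      using Suc J strict by (intro strictS) auto
    then have "card (S (J i)) < card (S (J (Suc i)))" using fin psubset_card_mono by blast
    then show ?case using Suc by simp
  qed simp
  then show ?thesis using cardS le_trans by blast
qed

text \<open>The series itself, taken modulo \<open>I\<close>, is a chain of length \<open>D\<close>;
  for any other chain, the preimages of its members form a strict chain of ideals, to which the
  preceding bound applies.\<close>

lemma module_length_composition_series:
  fixes I :: "'a::comm_ring_1 set"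
  assumes I: "ideal I Rt" and ser: "(covers ^^ D) I UNIV"
  shows "module_length Rt (quot_module Rt I) = enat D"
proof -
  obtain W where W0: "W 0 = I" and WD: "W D = UNIV"
    and W: "\<And>j. j < D \<Longrightarrow> covers (W j) (W (Suc j))"
    using ser unfolding relpowp_fun_conv by blast
  have mono: "I \<subseteq> W i" if "i \<le> D" for i
    using that
  proof (induction i)
    case (Suc i)
    then show ?case using W[of i] by (auto simp: covers_def)
  qed (simp add: W0)
  have ideal: "ideal (W i) Rt" if "i \<le> D" for i
    using that W[of "i - 1"] W0 I by (cases i) (auto simp: covers_def)
  show ?thesis unfolding module_length_def
  proof (rule antisym)
    show "enat D \<le> Sup {enat n |n. \<exists>N. (\<forall>i\<le>n. submodule (N i) Rt (quot_module Rt I)) \<and>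
        (\<forall>i<n. N i \<subset> N (Suc i))}"
    proof (rule Sup_upper, clarsimp, intro exI conjI allI impI)
      let ?N = "\<lambda>i. (\<lambda>f. I +>\<^bsub>Rt\<^esub> f) ` W i"
      show "submodule (?N i) Rt (quot_module Rt I)" if "i \<le> D" for i
        using submodule_quot_module_image[OF I ideal mono] that by simp
      show "?N i \<subset> ?N (Suc i)" if i: "i < D" for i
      proof -
        obtain f where f: "f \<in> W (Suc i)" "f \<notin> W i" and sub: "W i \<subseteq> W (Suc i)"
          using W[OF i] unfolding covers_def by blast
        have "I +>\<^bsub>Rt\<^esub> f \<notin> ?N i"
        proof
          assume "I +>\<^bsub>Rt\<^esub> f \<in> ?N i"
          then obtain g where "g \<in> W i" "f - g \<in> I" using coset_eq_iff[OF I] by auto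
          then have "g + (f - g) \<in> W i"
            using ideal[of i] mono[of i] i unfolding ideal_iff by (meson less_imp_le subsetD)
          then show False using f by simp
        qed
        then show ?thesis using f sub by blast
      qed
    qed
    show "Sup {enat n |n. \<exists>N. (\<forall>i\<le>n. submodule (N i) Rt (quot_module Rt I)) \<and>
        (\<forall>i<n. N i \<subset> N (Suc i))} \<le> enat D"
    proof (rule Sup_least, clarsimp)
      fix n N assume N: "\<forall>i\<le>n. submodule (N i) Rt (quot_module Rt I)"
        and st: "\<forall>i<n. N i \<subset> N (Suc i)"
      \<comment> \<open>Every element of a submodule is a coset of some ring element, so strict
        inclusions remain strict for preimages.\<close>
      have car: "N i \<subseteq> range (\<lambda>a. I +>\<^bsub>Rt\<^esub> a)" if "i \<le> n" for i
        using subgroup.subset[OF submodule.axioms(1), of "N i" Rt "quot_module Rt I"] N that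
        by (simp add: quot_module_def carrier_Quot)
      show "n \<le> D"
      proof (rule strict_chain_le_composition_length[OF W WD])
        let ?J = "\<lambda>i. {f. I +>\<^bsub>Rt\<^esub> f \<in> N i}"
        show "ideal (?J i) Rt" "W 0 \<subseteq> ?J i" if "i \<le> n" for i
          using submodule_quot_module_preimage[OF I] N that by (auto simp: W0)
        show "?J i \<subset> ?J (Suc i)" if i: "i < n" for i
        proof -
          obtain C where C: "C \<in> N (Suc i)" "C \<notin> N i" and sub: "N i \<subseteq> N (Suc i)"
            using st i by blast
          then obtain a where "C = I +>\<^bsub>Rt\<^esub> a" using car[of "Suc i"] i by auto
          then show ?thesis using C sub by blast
        qed
      qed
    qed
  qed
qed

section \<open>Ideals given by divisibility of homogeneous parts\<close>

text \<open>The homogeneous part of degree \<open>d\<close> at \<open>x = 1\<close>, \<open>y = t\<close>; the coefficient of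
  \<open>x\<^sup>i y\<^sup>j\<close> in \<open>f\<close> is \<open>f $ j $ i\<close>.\<close>

definition hpoly :: "nat \<Rightarrow> cxy \<Rightarrow> complex poly" where
  "hpoly d f = (\<Sum>j\<le>d. monom (f $ j $ (d - j)) j)"

lemma coeff_hpoly: "coeff (hpoly d f) j = (if j \<le> d then f $ j $ (d - j) else 0)"
  by (simp add: hpoly_def coeff_sum coeff_monom)

lemma degree_hpoly: "degree (hpoly d f) \<le> d"
  by (rule degree_le) (simp add: coeff_hpoly)

lemma hpoly_add: "hpoly d (f + g) = hpoly d f + hpoly d g"
  by (rule poly_eqI) (simp add: coeff_hpoly)

lemma hpoly_diff: "hpoly d (f - g) = hpoly d f - hpoly d g"
  by (rule poly_eqI) (simp add: coeff_hpoly)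

lemma hpoly_0 [simp]: "hpoly d 0 = 0"
  by (rule poly_eqI) (simp add: coeff_hpoly)

lemma hpoly_eq_0_iff: "(\<forall>d. hpoly d f = 0) \<longleftrightarrow> f = 0"
proof
  assume *: "\<forall>d. hpoly d f = 0"
  have "f $ j $ i = 0" for i j
    using *[rule_format, of "i + j"] coeff_hpoly[of "i + j" f j] by simp
  then show "f = 0" by (simp add: fps_eq_iff)
qed simp

text \<open>The grading is multiplicative, and setting x = 1 respects products. The proof compares
  coefficients, regrouping a sum over pairs of exponents by total degree.\<close>

lemma hpoly_mult: "hpoly n (f * g) = (\<Sum>e\<le>n. hpoly e f * hpoly (n - e) g)"
proof (rule poly_eqI)
  fix j
  show "coeff (hpoly n (f * g)) j = coeff (\<Sum>e\<le>n. hpoly e f * hpoly (n - e) g) j"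
  proof (cases "j \<le> n")
    case True
    \<comment> \<open>\<open>F a b\<close> pairs the monomial of \<open>f\<close> with y-exponent
      \<open>a\<close> and x-exponent \<open>b\<close> with the complementary monomial of
      \<open>g\<close>.\<close>
    define F where "F a b = f $ a $ b * g $ (j - a) $ (n - j - b)" for a b
    have "coeff (hpoly n (f * g)) j = (\<Sum>a\<le>j. \<Sum>b\<le>n - j. F a b)"
      using True by (simp add: coeff_hpoly fps_mult_nth fps_sum_nth F_def atLeast0AtMost)
    \<comment> \<open>The new index e = a + b is the total degree of the monomial taken from
      \<open>f\<close>.\<close>
    also have "\<dots> = (\<Sum>a\<le>j. \<Sum>e\<le>n. if a \<le> e \<and> e - a \<le> n - j then F a (e - a) else 0)"
    proof (rule sum.cong[OF refl])
      fix a assume "a \<in> {..j}"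
      then have a: "a \<le> j" by simp
      have "(\<Sum>b\<le>n - j. F a b) = (\<Sum>e\<in>{e\<in>{..n}. a \<le> e \<and> e - a \<le> n - j}. F a (e - a))"
        by (rule sum.reindex_bij_witness[where i = "\<lambda>e. e - a" and j = "\<lambda>b. b + a"])
          (use a True in auto)
      also have "\<dots> = (\<Sum>e\<le>n. if a \<le> e \<and> e - a \<le> n - j then F a (e - a) else 0)"
        by (subst sum.inter_filter) auto
      finally show "(\<Sum>b\<le>n - j. F a b) = \<dots>" .
    qed
    also have "\<dots> = (\<Sum>e\<le>n. \<Sum>a\<le>j. if a \<le> e \<and> e - a \<le> n - j then F a (e - a) else 0)"
      by (rule sum.swap)
    also have "\<dots> = (\<Sum>e\<le>n. \<Sum>a\<le>j. coeff (hpoly e f) a * coeff (hpoly (n - e) g) (j - a))"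
    proof (intro sum.cong refl)
      fix e a assume "e \<in> {..n}" "a \<in> {..j}"
      then have "a \<le> e \<and> e - a \<le> n - j \<longleftrightarrow> a \<le> e \<and> j - a \<le> n - e"
        "a \<le> e \<Longrightarrow> j - a \<le> n - e \<Longrightarrow> n - j - (e - a) = n - e - (j - a)"
        using True by auto
      then show "(if a \<le> e \<and> e - a \<le> n - j then F a (e - a) else 0) =
          coeff (hpoly e f) a * coeff (hpoly (n - e) g) (j - a)"
        by (auto simp: coeff_hpoly F_def)
    qed
    finally show ?thesis by (simp add: coeff_sum coeff_mult)
  next
    case False
    have "degree (hpoly e f * hpoly (n - e) g) < j" if "e \<le> n" for e
      using degree_mult_le[of "hpoly e f" "hpoly (n - e) g"] degree_hpoly[of e f]
        degree_hpoly[of "n - e" g] that False by linarith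
    then show ?thesis using False by (simp add: coeff_hpoly coeff_sum coeff_eq_0)
  qed
qed

text \<open>The form of degree \<open>d\<close> that becomes \<open>p\<close> at x = 1, provided
  that \<open>p\<close> has degree at most \<open>d\<close>; coefficients beyond \<open>d\<close>
  are dropped.\<close>

definition homog :: "nat \<Rightarrow> complex poly \<Rightarrow> cxy" where
  "homog d p = Abs_fps (\<lambda>j. Abs_fps (\<lambda>i. if i + j = d then coeff p j else 0))"

lemma hpoly_homog: "degree p \<le> d \<Longrightarrow> hpoly e (homog d p) = (if e = d then p else 0)"
  by (rule poly_eqI) (auto simp: coeff_hpoly homog_def coeff_eq_0)

lemma hpoly_const_mult: "hpoly d (fps_const (fps_const c) * f) = smult c (hpoly d f)"
  by (rule poly_eqI) (simp add: coeff_hpoly)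

definition hideal :: "nat \<Rightarrow> (nat \<Rightarrow> complex poly) \<Rightarrow> cxy set" where
  "hideal m Q = {f. \<forall>d<m. Q d dvd hpoly d f}"

text \<open>A multiplier moves homogeneous parts into higher degrees only, so it suffices that the
  required divisors get weaker as the degree grows.\<close>

lemma ideal_hideal:
  assumes "\<And>d e. d \<le> e \<Longrightarrow> e < m \<Longrightarrow> Q e dvd Q d"
  shows "ideal (hideal m Q) Rt"
  unfolding ideal_iff
proof (intro conjI ballI allI)
  show "0 \<in> hideal m Q" by (simp add: hideal_def)
  show "f + g \<in> hideal m Q" if "f \<in> hideal m Q" "g \<in> hideal m Q" for f g
    using that by (simp add: hideal_def hpoly_add)
  fix r f assume f: "f \<in> hideal m Q"
  show "r * f \<in> hideal m Q"
    unfolding hideal_def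
  proof (clarify)
    fix d assume d: "d < m"
    show "Q d dvd hpoly d (r * f)"
      unfolding hpoly_mult
    proof (rule dvd_sum)
      fix e assume "e \<in> {..d}"
      then have "Q d dvd Q (d - e)" "Q (d - e) dvd hpoly (d - e) f"
        using assms d f by (auto simp: hideal_def)
      then show "Q d dvd hpoly e r * hpoly (d - e) f" using dvd_trans dvd_mult by blast
    qed
  qed
qed

text \<open>Splitting off one linear factor of \<open>q\<close> either cuts the dimension by one, or, as soon as
  \<open>degree q > d\<close>, does nothing because both conditions then say that the homogeneous part vanishes.\<close>

lemma composition_series_degree:
  assumes "\<And>a b. a \<le> b \<Longrightarrow> b < d \<Longrightarrow> Q b dvd Q a" "\<And>a. a < d \<Longrightarrow> q dvd Q a" "q \<noteq> 0"
  shows "(covers ^^ min (Suc d) (degree q)) (hideal (Suc d) (Q(d := q))) (hideal d Q)"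
  using assms(2,3)
proof (induction "degree q" arbitrary: q)
  case 0
  then have "q dvd 1" by (simp add: is_unit_iff_degree)
  then have "q dvd p" for p using dvd_trans one_dvd by blast
  then have eq: "hideal (Suc d) (Q(d := q)) = hideal d Q" by (auto simp: hideal_def less_Suc_eq)
  show ?case unfolding eq using 0 by simp
next
  case (Suc n)
  have "\<not> constant (poly q)" using Suc.hyps(2) by (simp add: constant_degree)
  then obtain a where "poly q a = 0" using fundamental_theorem_of_algebra by blast
  then obtain p where q: "q = [:-a, 1:] * p" using poly_eq_0_iff_dvd by (metis dvdE)
  then have p0: "p \<noteq> 0" using Suc.prems by auto
  then have "degree q = Suc (degree p)" unfolding q by (subst degree_mult_eq) auto
  then have dp: "degree p = n" using Suc.hyps(2) by simp
  have pq: "p dvd q" unfolding q by (rule dvd_triv_right)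
  have "(covers ^^ min (Suc d) (degree p)) (hideal (Suc d) (Q(d := p))) (hideal d Q)"
    using Suc.hyps(1)[of p] Suc.prems dp p0 pq dvd_trans by blast
  note IH = this[unfolded dp]
  let ?I = "hideal (Suc d) (Q(d := q))" and ?J = "hideal (Suc d) (Q(d := p))"
  have idI: "ideal ?I Rt" and idJ: "ideal ?J Rt"
    using assms(1) Suc.prems pq dvd_trans[OF pq] by (auto intro!: ideal_hideal simp: less_Suc_eq)
  show ?case
  proof (cases "n \<le> d")
    case True
    have "covers ?I ?J"
      unfolding covers_def
    proof (intro conjI idI idJ ballI)
      \<comment> \<open>The form given by \<open>p\<close> itself separates the two ideals:
        \<open>q\<close> has larger degree than the nonzero \<open>p\<close> and cannot divide
        it.\<close>
      have "homog d p \<in> ?J" "homog d p \<notin> ?I"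
        using True dp p0 Suc.hyps(2) dvd_imp_degree_le[of q p]
        by (auto simp: hideal_def hpoly_homog less_Suc_eq)
      moreover have "?I \<subseteq> ?J" using dvd_trans[OF pq] by (auto simp: hideal_def)
      ultimately show "?I \<subset> ?J" by blast
      fix f g assume f: "f \<in> ?J" and g: "g \<in> ?J - ?I"
      have "p dvd hpoly d f" "p dvd hpoly d g"
        using f g by (auto simp: hideal_def less_Suc_eq)
      then obtain r s where r: "hpoly d f = p * r" and s: "hpoly d g = p * s"
        by (elim dvdE)
      \<comment> \<open>Evaluation of the cofactor at the root \<open>a\<close> is thus a linear
        functional that cuts out the smaller ideal; this is why the layer is
        one-dimensional.\<close>
      have qdvd: "q dvd p * u \<longleftrightarrow> poly u a = 0" for u
        using p0 dvd_mult_cancel_right[of "[:-a, 1:]" p u]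
        by (simp only: q mult.commute[of p u] poly_eq_0_iff_dvd simp_thms)
      have "\<not> q dvd p * s" using g s by (auto simp: hideal_def less_Suc_eq)
      then have sa: "poly s a \<noteq> 0" by (simp add: qdvd)
      \<comment> \<open>The scalar for which the cofactor of the difference vanishes at
        \<open>a\<close>.\<close>
      define c where "c = poly r a / poly s a"
      have "q dvd p * (r - smult c s)"
        using sa by (simp add: c_def qdvd)
      also have "p * (r - smult c s) = hpoly d (f - fps_const (fps_const c) * g)"
        by (simp add: hpoly_diff hpoly_const_mult r s right_diff_distrib)
      finally have "f - fps_const (fps_const c) * g \<in> ?I"
        using f g by (auto simp: hideal_def hpoly_diff hpoly_const_mult less_Suc_eq dvd_diff dvd_smult)
      then show "\<exists>c. f - c * g \<in> ?I" by blast
    qed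
    then have "(covers ^^ Suc n) ?I (hideal d Q)"
      using IH True by (intro relpowp_Suc_I2) auto
    then show ?thesis using True Suc.hyps(2)[symmetric] by simp
  next
    case False
    have "u dvd hpoly d f \<longleftrightarrow> hpoly d f = 0" if "degree u > d" for u f
      using dvd_imp_degree_le[of u "hpoly d f"] degree_hpoly[of d f] that by auto
    then have "?I = ?J" using False dp Suc.hyps(2) by (auto simp: hideal_def less_Suc_eq)
    then show ?thesis using IH False Suc.hyps(2) by (simp add: min_def)
  qed
qed

text \<open>The conditions are released one degree at a time from the top. Degree \<open>d\<close>
  contributes the codimension of the multiples of \<open>Q d\<close> in the space of forms of degree
  \<open>d\<close>, whose dimension is d + 1.\<close>

lemma module_length_hideal:
  assumes "\<And>d e. d \<le> e \<Longrightarrow> e < m \<Longrightarrow> Q e dvd Q d" "\<And>d. d < m \<Longrightarrow> Q d \<noteq> 0"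
  shows "module_length Rt (quot_module Rt (hideal m Q)) = enat (\<Sum>d<m. min (Suc d) (degree (Q d)))"
proof (rule module_length_composition_series[OF ideal_hideal[OF assms(1)]])
  show "(covers ^^ (\<Sum>d<m. min (Suc d) (degree (Q d)))) (hideal m Q) UNIV"
    using assms
  proof (induction m)
    case 0
    then show ?case by (simp add: hideal_def)
  next
    case (Suc m)
    have "(covers ^^ min (Suc m) (degree (Q m))) (hideal (Suc m) (Q(m := Q m))) (hideal m Q)"
      using Suc.prems by (intro composition_series_degree) auto
    moreover have "(covers ^^ (\<Sum>d<m. min (Suc d) (degree (Q d)))) (hideal m Q) UNIV"
      using Suc by auto
    ultimately show ?case by (auto simp: add.commute relpowp_add)
  qed
qed auto

section \<open>Monomial valuations\<close>

text \<open>The extension of \<nu> to the fraction field as a difference of values. The choice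
  operator fixes one representation; additivity of \<nu> makes the value independent of it.\<close>

definition fract_val :: "('a::idom \<Rightarrow> nat) \<Rightarrow> 'a fract \<Rightarrow> ereal" where
  "fract_val \<nu> q = (if q = 0 then \<infinity> else
     (let (a, b) = (SOME (a, b). b \<noteq> 0 \<and> q = Fract a b) in ereal (real (\<nu> a) - real (\<nu> b))))"

lemma fract_val_Fract:
  assumes mult: "\<And>f g. f \<noteq> 0 \<Longrightarrow> g \<noteq> 0 \<Longrightarrow> \<nu> (f * g) = \<nu> f + \<nu> g"
    and "a \<noteq> 0" "b \<noteq> 0"
  shows "fract_val \<nu> (Fract a b) = ereal (real (\<nu> a) - real (\<nu> b))"
proof -
  have nz: "Fract a b \<noteq> 0" using assms by (simp add: Zero_fract_def eq_fract)
  obtain c d where cd: "(SOME (c, d). d \<noteq> 0 \<and> Fract a b = Fract c d) = (c, d)" by fastforce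
  have "case (c, d) of (c, d) \<Rightarrow> d \<noteq> 0 \<and> Fract a b = Fract c d"
    unfolding cd[symmetric] by (rule someI[of _ "(a, b)"]) (use assms in simp)
  then have d: "d \<noteq> 0" and eq: "a * d = c * b" using assms by (auto simp: eq_fract)
  then have "c \<noteq> 0" using assms by auto
  then have "\<nu> a + \<nu> d = \<nu> c + \<nu> b" using mult[of a d] mult[of c b] eq d assms by simp
  then have "real (\<nu> a) + real (\<nu> d) = real (\<nu> c) + real (\<nu> b)"
    by (simp only: flip: of_nat_add)
  then show ?thesis unfolding fract_val_def using nz cd by simp
qed

lemma real_valuation_fract_val:
  assumes mult: "\<And>f g. f \<noteq> 0 \<Longrightarrow> g \<noteq> 0 \<Longrightarrow> \<nu> (f * g) = \<nu> f + \<nu> g"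
    and add: "\<And>f g. f \<noteq> 0 \<Longrightarrow> g \<noteq> 0 \<Longrightarrow> f + g \<noteq> 0 \<Longrightarrow> min (\<nu> f) (\<nu> g) \<le> \<nu> (f + g)"
  shows "real_valuation (fract_val \<nu>)"
  unfolding real_valuation_def
proof (intro conjI allI impI)
  note V = fract_val_Fract[OF mult]
  have zero: "fract_val \<nu> 0 = \<infinity>" by (simp add: fract_val_def)
  have nz: "Fract a b \<noteq> 0 \<longleftrightarrow> a \<noteq> 0" if "b \<noteq> 0" for a b :: 'a
    using that by (simp add: Zero_fract_def eq_fract)
  show "fract_val \<nu> 0 = \<infinity>" by (rule zero)
  show "\<bar>fract_val \<nu> q\<bar> \<noteq> \<infinity>" if "q \<noteq> 0" for q
    using that by (cases q) (auto simp: V nz)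
  show "fract_val \<nu> (p * q) = fract_val \<nu> p + fract_val \<nu> q" for p q
  proof (cases "p = 0 \<or> q = 0")
    case True
    have "fract_val \<nu> r \<noteq> - \<infinity>" for r
      by (cases r, cases "r = 0") (auto simp: zero V nz)
    then show ?thesis using True zero by auto
  next
    case False
    then show ?thesis by (cases p; cases q) (auto simp: nz V mult)
  qed
  show "min (fract_val \<nu> p) (fract_val \<nu> q) \<le> fract_val \<nu> (p + q)" for p q
  proof (cases "p = 0 \<or> q = 0 \<or> p + q = 0")
    case True
    then show ?thesis using zero by auto
  next
    case False
    obtain a b c d where p: "p = Fract a b" "b \<noteq> 0" and q: "q = Fract c d" "d \<noteq> 0"
      by (meson Fract_cases)
    then have ac: "a \<noteq> 0" "c \<noteq> 0" "a * d + c * b \<noteq> 0" using False by (auto simp: nz)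
    \<comment> \<open>The numerators over the common denominator \<open>b * d\<close> are
      compared.\<close>
    then have "min (\<nu> a + \<nu> d) (\<nu> c + \<nu> b) \<le> \<nu> (a * d + c * b)"
      using add[of "a * d" "c * b"] p q by (simp add: mult)
    then show ?thesis using p q ac by (auto simp: V mult min_def)
  qed
qed

text \<open>The monomial valuation with weight \<open>1\<close> on \<open>x\<close> and \<open>1 + w\<close> on \<open>y - c x\<close>.  The factor
  \<open>(y - c x)\<^sup>k\<close> of a homogeneous form becomes \<open>(t - c)\<^sup>k\<close> after setting \<open>x = 1\<close>, \<open>y = t\<close>.\<close>

definition mono_ord :: "complex \<Rightarrow> nat \<Rightarrow> cxy \<Rightarrow> nat" where
  "mono_ord c w f = (LEAST n. \<exists>d. hpoly d f \<noteq> 0 \<and> n = d + w * order c (hpoly d f))"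

lemma mono_ord_attained:
  assumes "f \<noteq> 0"
  shows "\<exists>d. hpoly d f \<noteq> 0 \<and> mono_ord c w f = d + w * order c (hpoly d f)"
proof -
  obtain d where "hpoly d f \<noteq> 0" using assms hpoly_eq_0_iff by blast
  then have "\<exists>n d. hpoly d f \<noteq> 0 \<and> n = d + w * order c (hpoly d f)" by blast
  then show ?thesis unfolding mono_ord_def by (rule LeastI_ex)
qed

lemma mono_ord_le: "hpoly d f \<noteq> 0 \<Longrightarrow> mono_ord c w f \<le> d + w * order c (hpoly d f)"
  unfolding mono_ord_def by (rule Least_le) blast

lemma le_mono_ord_iff:
  assumes "f \<noteq> 0"
  shows "n \<le> mono_ord c w f \<longleftrightarrow> (\<forall>d. hpoly d f \<noteq> 0 \<longrightarrow> n \<le> d + w * order c (hpoly d f))"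
  using mono_ord_attained[OF assms, of c w] mono_ord_le order_trans by metis

text \<open>Divisibility by a power of the linear factor passes to sums and includes zero summands,
  whose order says nothing.\<close>

lemma order_sum_ge:
  fixes F :: "'b \<Rightarrow> 'a::idom poly"
  assumes "finite A" "\<And>x. x \<in> A \<Longrightarrow> F x \<noteq> 0 \<Longrightarrow> n \<le> order c (F x)" "sum F A \<noteq> 0"
  shows "n \<le> order c (sum F A)"
proof -
  have "[:-c, 1:] ^ n dvd sum F A"
    by (rule dvd_sum) (use assms(2) in \<open>auto simp: order_divides\<close>)
  then show ?thesis using assms(3) by (simp add: order_divides)
qed

lemma mono_ord_add:
  assumes "f \<noteq> 0" "g \<noteq> 0" "f + g \<noteq> 0"
  shows "min (mono_ord c w f) (mono_ord c w g) \<le> mono_ord c w (f + g)"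
  unfolding le_mono_ord_iff[OF assms(3)]
proof (intro allI impI)
  fix d assume nz: "hpoly d (f + g) \<noteq> 0"
  let ?p = "hpoly d f" and ?q = "hpoly d g"
  \<comment> \<open>Otherwise both parts would be divisible by a higher power of the linear factor
    than their sum.\<close>
  have "(\<exists>r\<in>{?p, ?q}. r \<noteq> 0 \<and> order c r \<le> order c (?p + ?q))"
  proof (rule ccontr)
    assume H: "\<not> ?thesis"
    have "[:-c, 1:] ^ Suc (order c (?p + ?q)) dvd ?p" "[:-c, 1:] ^ Suc (order c (?p + ?q)) dvd ?q"
      using H unfolding order_divides by (auto simp: not_le Suc_le_eq)
    then have "[:-c, 1:] ^ Suc (order c (?p + ?q)) dvd ?p + ?q" by (rule dvd_add)
    then show False using nz unfolding order_divides by (simp add: hpoly_add)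
  qed
  then show "min (mono_ord c w f) (mono_ord c w g) \<le> d + w * order c (hpoly d (f + g))"
  proof
    fix r assume r: "r \<in> {?p, ?q}" and r0: "r \<noteq> 0 \<and> order c r \<le> order c (?p + ?q)"
    have "min (mono_ord c w f) (mono_ord c w g) \<le> d + w * order c r"
      using r r0 mono_ord_le[of d f c w] mono_ord_le[of d g c w] by auto
    also have "\<dots> \<le> d + w * order c (hpoly d (f + g))" using r0 by (simp add: hpoly_add)
    finally show ?thesis .
  qed
qed

text \<open>Superadditivity follows from the convolution formula. Equality is an argument in the
  style of the Gauss lemma: the lowest degrees where the two minima are attained produce a term of
  the product that cannot be cancelled.\<close>

lemma mono_ord_mult:
  assumes "f \<noteq> 0" "g \<noteq> 0" and w: "w > 0"
  shows "mono_ord c w (f * g) = mono_ord c w f + mono_ord c w g"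
proof -
  let ?v = "mono_ord c w"
  have fg: "f * g \<noteq> 0" using assms by simp
  let ?A = "\<lambda>f d. hpoly d f \<noteq> 0 \<and> ?v f = d + w * order c (hpoly d f)"
  \<comment> \<open>Several degrees may attain the minimum; taking the least one makes the
    inequality strict in all lower degrees.\<close>
  define a where "a = (LEAST d. ?A f d)"
  define b where "b = (LEAST d. ?A g d)"
  have a: "hpoly a f \<noteq> 0" "?v f = a + w * order c (hpoly a f)"
    using LeastI_ex[OF mono_ord_attained[OF assms(1), of c w]] by (auto simp: a_def)
  have b: "hpoly b g \<noteq> 0" "?v g = b + w * order c (hpoly b g)"
    using LeastI_ex[OF mono_ord_attained[OF assms(2), of c w]] by (auto simp: b_def)
  have alt: "?v f < d + w * order c (hpoly d f)" if "d < a" "hpoly d f \<noteq> 0" for d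
    using not_less_Least[of d "?A f"] that mono_ord_le[of d f c w] by (auto simp: a_def)
  have blt: "?v g < d + w * order c (hpoly d g)" if "d < b" "hpoly d g \<noteq> 0" for d
    using not_less_Least[of d "?A g"] that mono_ord_le[of d g c w] by (auto simp: b_def)
  show ?thesis
  proof (rule antisym)
    show "?v f + ?v g \<le> ?v (f * g)"
      unfolding le_mono_ord_iff[OF fg]
    proof (intro allI impI)
      fix n assume nz: "hpoly n (f * g) \<noteq> 0"
      have "\<exists>e\<le>n. hpoly e f * hpoly (n - e) g \<noteq> 0 \<and>
          order c (hpoly e f * hpoly (n - e) g) \<le> order c (hpoly n (f * g))"
      proof (rule ccontr)
        assume H: "\<not> ?thesis"
        then have "Suc (order c (hpoly n (f * g))) \<le> order c (hpoly e f * hpoly (n - e) g)"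
          if "e \<in> {..n}" "hpoly e f * hpoly (n - e) g \<noteq> 0" for e
          using that by (meson atMost_iff not_less_eq_eq)
        then have "Suc (order c (hpoly n (f * g))) \<le> order c (\<Sum>e\<le>n. hpoly e f * hpoly (n - e) g)"
          using nz by (intro order_sum_ge) (auto simp: hpoly_mult[of n f g])
        then have "Suc (order c (hpoly n (f * g))) \<le> order c (hpoly n (f * g))"
          by (simp only: hpoly_mult[of n f g])
        then show False by simp
      qed
      then obtain e where e: "e \<le> n" "hpoly e f * hpoly (n - e) g \<noteq> 0"
        "order c (hpoly e f * hpoly (n - e) g) \<le> order c (hpoly n (f * g))" by blast
      have "?v f + ?v g \<le> (e + w * order c (hpoly e f)) + ((n - e) + w * order c (hpoly (n - e) g))"
        using e by (intro add_mono mono_ord_le) auto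
      also have "\<dots> = n + w * order c (hpoly e f * hpoly (n - e) g)"
        using e by (simp add: order_mult[OF e(2)] algebra_simps)
      also have "\<dots> \<le> n + w * order c (hpoly n (f * g))" using e by simp
      finally show "?v f + ?v g \<le> n + w * order c (hpoly n (f * g))" .
    qed
    let ?o = "order c (hpoly a f) + order c (hpoly b g)"
    define S where "S = (\<Sum>e\<in>{..a + b} - {a}. hpoly e f * hpoly (a + b - e) g)"
    have split: "hpoly (a + b) (f * g) = hpoly a f * hpoly b g + S"
      unfolding hpoly_mult S_def by (subst sum.remove[of _ a]) auto
    have ab: "order c (hpoly a f * hpoly b g) = ?o" using a b by (intro order_mult) auto
    have "[:-c, 1:] ^ Suc ?o dvd S"
      unfolding S_def
    proof (rule dvd_sum)
      fix e assume "e \<in> {..a + b} - {a}"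
      then have e: "e \<le> a + b" "e \<noteq> a" by auto
      let ?p = "hpoly e f" and ?q = "hpoly (a + b - e) g"
      \<comment> \<open>In any other splitting of a + b one index is below \<open>a\<close> or the
        other is below \<open>b\<close>, so the total value is strictly larger. The degree is the
        same, and \<open>w > 0\<close> makes the excess an excess of order.\<close>
      have "Suc ?o \<le> order c (?p * ?q)" if nz: "?p * ?q \<noteq> 0"
      proof -
        have "?v f + ?v g < (e + w * order c ?p) + ((a + b - e) + w * order c ?q)"
        proof (cases "e < a")
          case True
          then show ?thesis using alt[of e] mono_ord_le[of "a + b - e" g c w] nz
            by (intro add_less_le_mono) auto
        next
          case False
          then have "a + b - e < b" using e by auto
          then show ?thesis using blt[of "a + b - e"] mono_ord_le[of e f c w] nz
            by (intro add_le_less_mono) auto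
        qed
        then have "w * ?o < w * (order c ?p + order c ?q)" using a b e by (simp add: algebra_simps)
        then show ?thesis using order_mult[OF nz] w by simp
      qed
      then show "[:-c, 1:] ^ Suc ?o dvd ?p * ?q" unfolding order_divides by blast
    qed
    moreover have ndvd: "\<not> [:-c, 1:] ^ Suc ?o dvd hpoly a f * hpoly b g"
      unfolding order_divides using a b ab by auto
    \<comment> \<open>Exactly one summand fails to be divisible by this power, hence so does the
      sum.\<close>
    ultimately have *: "\<not> [:-c, 1:] ^ Suc ?o dvd hpoly (a + b) (f * g)"
      unfolding split by (simp only: dvd_add_left_iff not_False_eq_True)
    then have "hpoly (a + b) (f * g) \<noteq> 0" "order c (hpoly (a + b) (f * g)) \<le> ?o"
      unfolding order_divides by auto
    then have "?v (f * g) \<le> (a + b) + w * ?o"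
      using mono_ord_le[of "a + b" "f * g" c w] by (meson add_left_mono mult_le_mono2 order_trans)
    then show "?v (f * g) \<le> ?v f + ?v g" using a b by (simp add: algebra_simps)
  qed
qed

section \<open>Intersections of monomial valuation filtrations\<close>

lemma fract_val_of_ring:
  assumes mult: "\<And>f g. f \<noteq> 0 \<Longrightarrow> g \<noteq> 0 \<Longrightarrow> \<nu> (f * g) = \<nu> f + \<nu> g"
  shows "fract_val \<nu> (Fract f 1) = (if f = 0 then \<infinity> else ereal (real (\<nu> f)))"
proof -
  have "\<nu> 1 = 0" using mult[of 1 1] by simp
  then show ?thesis
    using fract_val_Fract[OF mult, of f 1] by (auto simp: fract_val_def Zero_fract_def)
qed

definition mono_val :: "complex \<Rightarrow> nat \<Rightarrow> cxy fract \<Rightarrow> ereal" where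
  "mono_val c w = fract_val (mono_ord c w)"

text \<open>A pair (c, w) encodes \<open>mono_val c w\<close>. The index set may be infinite, so the
  members of the sequence and their intersection are instances of one construction.\<close>

definition mono_fil :: "(complex \<times> nat) set \<Rightarrow> cxy filtration" where
  "mono_fil V = Inter_fil ((\<lambda>(c, w). mono_val c w) ` V) valuation_fil"

lemma mono_val_of_ring:
  "w > 0 \<Longrightarrow> mono_val c w (Fract f 1) = (if f = 0 then \<infinity> else ereal (real (mono_ord c w f)))"
  unfolding mono_val_def by (rule fract_val_of_ring) (rule mono_ord_mult)

lemma real_valuation_mono_val: "w > 0 \<Longrightarrow> real_valuation (mono_val c w)"
  unfolding mono_val_def
  by (rule real_valuation_fract_val) (auto intro: mono_ord_mult mono_ord_add)

text \<open>Only the part of degree 0 can contribute the value 0, and as a nonzero constant it has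
  order 0 at every \<open>c\<close>.\<close>

lemma mono_ord_pos_iff: "f \<noteq> 0 \<Longrightarrow> mono_ord c w f > 0 \<longleftrightarrow> f $ 0 $ 0 = 0"
proof -
  assume f: "f \<noteq> 0"
  have h0: "hpoly 0 f = [:f $ 0 $ 0:]" by (simp add: hpoly_def monom_0)
  have "(\<forall>d. hpoly d f \<noteq> 0 \<longrightarrow> 1 \<le> d + w * order c (hpoly d f)) \<longleftrightarrow> f $ 0 $ 0 = 0" (is "?L \<longleftrightarrow> ?R")
  proof
    assume ?L
    show ?R
    proof (rule ccontr)
      assume "f $ 0 $ 0 \<noteq> 0"
      then have "hpoly 0 f \<noteq> 0" "order c (hpoly 0 f) = 0" by (simp_all add: h0 order_0I)
      then show False using \<open>?L\<close>[rule_format, of 0] by simp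
    qed
  next
    assume ?R
    then show ?L using h0 by (metis Suc_leI One_nat_def gr0I trans_le_add1 pCons_0_0)
  qed
  then show ?thesis using le_mono_ord_iff[OF f, of 1 c w] by (simp add: Suc_le_eq)
qed

section \<open>The maximal ideal and its powers\<close>

lemma xy_decomposition:
  fixes f :: cxy
  assumes "f $ 0 $ 0 = 0"
  shows "f = fps_const (fps_shift 1 (f $ 0)) * x_var + fps_shift 1 f * y_var"
proof -
  \<comment> \<open>\<open>f $ 0\<close> is f(x, 0), which is divisible by x as its constant term
    vanishes; what remains of \<open>f\<close> is divisible by y.\<close>
  have "f $ 0 = fps_shift 1 (f $ 0) * fps_X"
    using assms by (auto simp: fps_eq_iff)
  then have "fps_const (f $ 0) = fps_const (fps_shift 1 (f $ 0)) * x_var"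
    by (metis fps_const_mult x_var_def)
  moreover have "f = fps_const (f $ 0) + fps_shift 1 f * y_var"
    by (rule fps_ext) (auto simp: y_var_def)
  ultimately show ?thesis by simp
qed

lemma mxy_eq: "mxy = {f. f $ 0 $ 0 = 0}"
proof -
  interpret ring Rxy by (rule ring_from_type_algebra)
  have "ideal {f :: cxy. f $ 0 $ 0 = 0} Rxy"
    unfolding ideal_iff by simp
  then have "mxy \<subseteq> {f. f $ 0 $ 0 = 0}"
    unfolding mxy_def by (rule genideal_minimal) (simp add: x_var_def y_var_def)
  moreover have "{f. f $ 0 $ 0 = 0} \<subseteq> mxy"
  proof
    have id: "ideal mxy Rxy" unfolding mxy_def by (rule genideal_ideal) simp
    have xy: "x_var \<in> mxy" "y_var \<in> mxy" unfolding mxy_def using genideal_self[of "{x_var, y_var}"] by auto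
    fix f :: cxy assume "f \<in> {f. f $ 0 $ 0 = 0}"
    then have f: "f = fps_const (fps_shift 1 (f $ 0)) * x_var + fps_shift 1 f * y_var"
      by (intro xy_decomposition) simp
    show "f \<in> mxy" by (subst f) (use id xy in \<open>simp add: ideal_iff\<close>)
  qed
  ultimately show ?thesis by blast
qed

text \<open>By induction: splitting off x and y leaves cofactors whose order is at least one less.
  This links homogeneous parts to linear boundedness.\<close>

lemma hpoly_vanishing_in_mxy_power:
  assumes "\<forall>d<N. hpoly d f = 0"
  shows "f \<in> mxy [^]\<^bsub>ideals_set Rxy\<^esub> N"
  using assms
proof (induction N arbitrary: f)
  case 0
  show ?case by (simp add: nat_pow_def ideals_set_def)
next
  case (Suc N)
  have z: "f $ j $ i = 0" if "i + j < Suc N" for i j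
    using coeff_hpoly[of "i + j" f j] Suc.prems that by simp
  let ?g = "fps_const (fps_shift 1 (f $ 0))" and ?h = "fps_shift 1 f"
  have "hpoly d ?g = 0" "hpoly d ?h = 0" if "d < N" for d
    using that by (auto intro!: poly_eqI simp: coeff_hpoly z)
  then have "?g \<in> mxy [^]\<^bsub>ideals_set Rxy\<^esub> N" "?h \<in> mxy [^]\<^bsub>ideals_set Rxy\<^esub> N"
    using Suc.IH by blast+
  moreover have "x_var \<in> mxy" "y_var \<in> mxy" by (simp_all add: mxy_eq x_var_def y_var_def)
  ultimately have "?g \<otimes>\<^bsub>Rxy\<^esub> x_var \<oplus>\<^bsub>Rxy\<^esub> ?h \<otimes>\<^bsub>Rxy\<^esub> y_var \<in> (mxy [^]\<^bsub>ideals_set Rxy\<^esub> N) \<cdot>\<^bsub>Rxy\<^esub> mxy"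
    by (intro ideal_prod.sum ideal_prod.prod)
  moreover have "f = ?g * x_var + ?h * y_var" using z[of 0 0] by (intro xy_decomposition) simp
  ultimately show ?case by (simp add: nat_pow_def ideals_set_def)
qed

lemma centered_at_mono_val: "w > 0 \<Longrightarrow> centered_at mxy (mono_val c w)"
  using mono_ord_pos_iff[of _ c w] by (auto simp: centered_at_def mono_val_of_ring mxy_eq)

section \<open>Membership criteria and the filtration axioms\<close>

lemma mem_mono_fil_iff:
  assumes "\<forall>(c, w)\<in>V. w > 0"
  shows "f \<in> mono_fil V s \<longleftrightarrow> f = 0 \<or> (\<forall>(c, w)\<in>V. s \<le> real (mono_ord c w f))"
  using assms by (fastforce simp: mono_fil_def Inter_fil_def valuation_fil_def mono_val_of_ring)

lemma le_mono_ord_real_iff: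
  assumes "f \<noteq> 0"
  shows "s \<le> real (mono_ord c w f) \<longleftrightarrow>
    (\<forall>d. hpoly d f \<noteq> 0 \<longrightarrow> s \<le> real (d + w * order c (hpoly d f)))"
  using mono_ord_attained[OF assms, of c w] mono_ord_le[of _ f c w]
  by (metis of_nat_le_iff order_trans)

text \<open>Phrased by homogeneous parts, the criterion covers \<open>f = 0\<close> without an
  exception, since the condition is then void.\<close>

lemma mem_mono_fil_hpoly_iff:
  assumes "\<forall>(c, w)\<in>V. w > 0"
  shows "f \<in> mono_fil V s \<longleftrightarrow>
    (\<forall>(c, w)\<in>V. \<forall>d. hpoly d f \<noteq> 0 \<longrightarrow> s \<le> real (d + w * order c (hpoly d f)))"
  unfolding mem_mono_fil_iff[OF assms] using le_mono_ord_real_iff[of f s]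
  by (cases "f = 0") simp_all

lemma mono_fil_mult:
  assumes V: "\<forall>(c, w)\<in>V. w > 0" and "f \<in> mono_fil V s" "g \<in> mono_fil V t"
  shows "f * g \<in> mono_fil V (s + t)"
  using assms(2,3) V mono_ord_mult[of f g] unfolding mem_mono_fil_iff[OF V]
  by (cases "f = 0 \<or> g = 0") (fastforce intro: add_mono)+

lemma mono_fil_nonpos: "\<forall>(c, w)\<in>V. w > 0 \<Longrightarrow> s \<le> 0 \<Longrightarrow> mono_fil V s = UNIV"
  by (auto simp: mem_mono_fil_iff intro: order_trans)

lemma ideal_mono_fil:
  assumes V: "\<forall>(c, w)\<in>V. w > 0"
  shows "ideal (mono_fil V s) Rxy"
  unfolding ideal_iff
proof (intro conjI ballI allI)
  show "0 \<in> mono_fil V s" by (simp add: mem_mono_fil_iff[OF V])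
  \<comment> \<open>Every ring element lies in the step at 0, so closure under multiplication is a
    case of multiplicativity of the filtration.\<close>
  show "r * f \<in> mono_fil V s" if "f \<in> mono_fil V s" for r f
    using mono_fil_mult[OF V, of r 0 f s] that mono_fil_nonpos[OF V, of 0] by simp
  show "f + g \<in> mono_fil V s" if "f \<in> mono_fil V s" "g \<in> mono_fil V s" for f g
  proof (cases "f = 0 \<or> g = 0 \<or> f + g = 0")
    case True
    then show ?thesis using that by (auto simp: mem_mono_fil_iff[OF V])
  next
    case False
    have "s \<le> real (mono_ord c w (f + g))" if cw: "(c, w) \<in> V" for c w
    proof -
      have "s \<le> real (mono_ord c w f)" "s \<le> real (mono_ord c w g)"
        using False cw \<open>f \<in> _\<close> \<open>g \<in> _\<close> by (auto simp: mem_mono_fil_iff[OF V])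
      moreover have "min (mono_ord c w f) (mono_ord c w g) \<le> mono_ord c w (f + g)"
        using False by (intro mono_ord_add) auto
      ultimately show ?thesis by linarith
    qed
    then show ?thesis by (auto simp: mem_mono_fil_iff[OF V])
  qed
qed

lemma mono_ord_power: "f \<noteq> 0 \<Longrightarrow> w > 0 \<Longrightarrow> mono_ord c w (f ^ k) = k * mono_ord c w f"
proof (induction k)
  case 0
  then show ?case using mono_ord_mult[of 1 1 w c] by simp
qed (simp add: mono_ord_mult)

lemma radical_mono_fil:
  assumes V: "\<forall>(c, w)\<in>V. w > 0" "V \<noteq> {}" and s: "s > 0"
  shows "radical Rxy (mono_fil V s) = mxy"
proof -
  have "(\<exists>k. f ^ k \<in> mono_fil V s) \<longleftrightarrow> f \<in> mxy" for f
  proof (cases "f = 0")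
    case True
    then have "f ^ 1 \<in> mono_fil V s" by (simp add: mem_mono_fil_iff[OF V(1)])
    moreover have "f \<in> mxy" using True by (simp add: mxy_eq)
    ultimately show ?thesis by blast
  next
    case False
    show ?thesis
    proof
      assume "\<exists>k. f ^ k \<in> mono_fil V s"
      then obtain k where k: "f ^ k \<in> mono_fil V s" by blast
      obtain c w where cw: "(c, w) \<in> V" using V by auto
      then have "s \<le> real (mono_ord c w (f ^ k))" "w > 0"
        using k False V(1) by (auto simp: mem_mono_fil_iff[OF V(1)])
      then have "s \<le> real (k * mono_ord c w f)" by (simp only: mono_ord_power[OF False])
      then have "mono_ord c w f > 0" using s by (intro gr0I) simp
      then show "f \<in> mxy" using mono_ord_pos_iff[OF False] by (simp add: mxy_eq)
    next
      assume "f \<in> mxy"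
      then have pos: "mono_ord c w f > 0" for c w using mono_ord_pos_iff[OF False] by (simp add: mxy_eq)
      \<comment> \<open>Elements of the maximal ideal have value at least 1 under every valuation,
        so one exponent serves all of \<open>V\<close>, even if \<open>V\<close> is
        infinite.\<close>
      define k where "k = nat \<lceil>s\<rceil>"
      have "s \<le> real (mono_ord c w (f ^ k))" if "(c, w) \<in> V" for c w
      proof -
        have "s \<le> real k" unfolding k_def by linarith
        also have "\<dots> \<le> real (k * mono_ord c w f)" using pos[of c w] by (simp del: of_nat_mult)
        finally show ?thesis using mono_ord_power[OF False, of w c k] V(1) that by auto
      qed
      then have "f ^ k \<in> mono_fil V s" by (auto simp: mem_mono_fil_iff[OF V(1)])
      then show "\<exists>k. f ^ k \<in> mono_fil V s" by blast
    qed
  qed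
  then show ?thesis by (auto simp: radical_def)
qed

text \<open>An element outside the maximal ideal has value 0 under every valuation, so cancelling it
  as a factor does not affect membership.\<close>

lemma primary_to_mono_fil:
  assumes V: "\<forall>(c, w)\<in>V. w > 0" "V \<noteq> {}" and s: "s > 0"
  shows "primary_to Rxy mxy (mono_fil V s)"
  unfolding primary_to_def primary_ideal_def radical_mono_fil[OF assms]
proof (intro conjI ballI impI refl)
  show "ideal (mono_fil V s) Rxy" by (rule ideal_mono_fil[OF V(1)])
  have "1 \<notin> mono_fil V s"
  proof
    assume "1 \<in> mono_fil V s"
    moreover obtain c w where "(c, w) \<in> V" using V by auto
    ultimately have "mono_ord c w 1 > 0" using s by (auto simp: mem_mono_fil_iff[OF V(1)])
    then show False using mono_ord_pos_iff[of 1 c w] by simp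
  qed
  then show "mono_fil V s \<noteq> carrier Rxy" by auto
  fix f g assume "f \<otimes>\<^bsub>Rxy\<^esub> g \<in> mono_fil V s"
  then have fg: "f * g \<in> mono_fil V s" by simp
  show "f \<in> mono_fil V s \<or> g \<in> mxy"
  proof (cases "f = 0 \<or> g = 0 \<or> g \<in> mxy")
    case True
    then show ?thesis by (auto simp: mem_mono_fil_iff[OF V(1)] mxy_eq)
  next
    case False
    then have "mono_ord c w g = 0" for c w using mono_ord_pos_iff[of g c w] by (auto simp: mxy_eq)
    then have "mono_ord c w (f * g) = mono_ord c w f" if "(c, w) \<in> V" for c w
      using False V(1) that mono_ord_mult[of f g w c] by auto
    then show ?thesis using fg False by (fastforce simp: mem_mono_fil_iff[OF V(1)])
  qed
qed

text \<open>A nonzero form of degree d vanishes to order at most d at \<open>c\<close>, so its value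
  is at most (1 + w) d. Any single member of \<open>V\<close> thus supplies the constant 1 / (1 +
  w).\<close>

lemma linearly_bounded_mono_fil:
  assumes V: "\<forall>(c, w)\<in>V. w > 0" "V \<noteq> {}"
  shows "linearly_bounded Rxy mxy (mono_fil V)"
proof -
  obtain c w where cw: "(c, w) \<in> V" using V by auto
  have "mono_fil V s \<subseteq> mxy [^]\<^bsub>ideals_set Rxy\<^esub> nat \<lceil>1 / (1 + real w) * s\<rceil>" for s
  proof (intro subsetI hpoly_vanishing_in_mxy_power allI impI)
    fix f d assume f: "f \<in> mono_fil V s" and d: "d < nat \<lceil>1 / (1 + real w) * s\<rceil>"
    show "hpoly d f = 0"
    proof (rule ccontr)
      assume nz: "hpoly d f \<noteq> 0"
      have "order c (hpoly d f) \<le> d" using order_degree[OF nz] degree_hpoly le_trans by blast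
      have "s \<le> real (d + w * order c (hpoly d f))"
        using f nz cw by (auto simp: mem_mono_fil_hpoly_iff[OF V(1)])
      also have "\<dots> \<le> real (d + w * d)"
        using \<open>order c (hpoly d f) \<le> d\<close> by (simp only: of_nat_le_iff add_le_cancel_left mult_le_mono2)
      also have "\<dots> = (1 + real w) * real d" by (simp add: algebra_simps)
      finally have "1 / (1 + real w) * s \<le> real d" by (simp add: field_simps)
      then show False using d by linarith
    qed
  qed
  moreover have "1 / (1 + real w) > 0" by simp
  ultimately show ?thesis unfolding linearly_bounded_def by blast
qed

lemma mono_fil_in_Fil:
  assumes V: "\<forall>(c, w)\<in>V. w > 0" "V \<noteq> {}"
  shows "mono_fil V \<in> Fil Rxy mxy"
proof -
  have anti: "mono_fil V t \<subseteq> mono_fil V s" if "s \<le> t" for s t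
    using that by (fastforce simp: mem_mono_fil_iff[OF V(1)])
  have prod: "mono_fil V s \<cdot>\<^bsub>Rxy\<^esub> mono_fil V t \<subseteq> mono_fil V (s + t)" for s t
  proof
    fix f assume "f \<in> mono_fil V s \<cdot>\<^bsub>Rxy\<^esub> mono_fil V t"
    then show "f \<in> mono_fil V (s + t)"
    proof induction
      case (prod i j)
      then show ?case using mono_fil_mult[OF V(1)] by simp
    next
      case (sum s1 s2)
      then show ?case using ideal_mono_fil[OF V(1), of "s + t"] by (simp add: ideal_iff)
    qed
  qed
  \<comment> \<open>Left continuity: a value that is at least every t < s is at least s.\<close>
  have cont: "mono_fil V s = (\<Inter>t\<in>{0..<s}. mono_fil V t)" if s: "s > 0" for s
  proof
    show "mono_fil V s \<subseteq> (\<Inter>t\<in>{0..<s}. mono_fil V t)"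
      by (intro INT_greatest anti) simp
    show "(\<Inter>t\<in>{0..<s}. mono_fil V t) \<subseteq> mono_fil V s"
    proof
      fix f assume f: "f \<in> (\<Inter>t\<in>{0..<s}. mono_fil V t)"
      show "f \<in> mono_fil V s"
      proof (cases "f = 0")
        case False
        have "s \<le> real (mono_ord c w f)" if cw: "(c, w) \<in> V" for c w
        proof (rule dense_le_bounded[OF s])
          fix t assume "0 < t" "t < s"
          then have "f \<in> mono_fil V t" using f by auto
          then show "t \<le> real (mono_ord c w f)" using cw False by (auto simp: mem_mono_fil_iff[OF V(1)])
        qed
        then show ?thesis by (auto simp: mem_mono_fil_iff[OF V(1)])
      qed (simp add: mem_mono_fil_iff[OF V(1)])
    qed
  qed
  show ?thesis
    using mono_fil_nonpos[OF V(1), of 0] primary_to_mono_fil[OF V] anti prod cont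
      linearly_bounded_mono_fil[OF V]
    by (simp add: Fil_def m_filtration_def)
qed

section \<open>Multiplicities\<close>

text \<open>Powers of distinct linear factors are coprime. Concretely, the product over
  \<open>A\<close> does not vanish at \<open>c a\<close>, so the full order of \<open>p\<close>
  there sits in the cofactor.\<close>

lemma prod_linear_powers_dvd:
  fixes p :: "'a::idom poly"
  assumes "finite A" "inj_on c A" "\<And>i. i \<in> A \<Longrightarrow> [:- c i, 1:] ^ e i dvd p"
  shows "(\<Prod>i\<in>A. [:- c i, 1:] ^ e i) dvd p"
  using assms
proof (induction A rule: finite_induct)
  case (insert a A)
  let ?P = "\<Prod>i\<in>A. [:- c i, 1:] ^ e i"
  have "?P dvd p" using insert by auto
  then obtain r where r: "p = ?P * r" by (elim dvdE)
  have "poly ?P (c a) \<noteq> 0" using insert by (auto simp: poly_prod inj_on_def)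
  then have o: "order (c a) ?P = 0" by (rule order_0I)
  have "[:- c a, 1:] ^ e a dvd r"
  proof (cases "p = 0")
    case False
    then have "e a \<le> order (c a) p" using insert.prems(2)[of a] by (simp add: order_divides)
    also have "\<dots> = order (c a) r" using False o unfolding r by (subst order_mult) auto
    finally show ?thesis by (simp add: order_divides)
  next
    case True
    moreover have "?P \<noteq> 0" using \<open>poly ?P (c a) \<noteq> 0\<close> by auto
    ultimately show ?thesis using r by simp
  qed
  then have "[:- c a, 1:] ^ e a * ?P dvd r * ?P" by (rule mult_dvd_mono) simp
  then show ?case using insert r by (simp add: mult.commute)
qed simp

lemma degree_prod_linear_powers:
  fixes c :: "'b \<Rightarrow> 'a::idom"
  shows "degree (\<Prod>i\<in>A. [:- c i, 1:] ^ e i) = (\<Sum>i\<in>A. e i)"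
  by (subst degree_prod_eq_sum_degree) (auto simp: degree_power_eq)

section \<open>Colengths in terms of rounded quotients\<close>

definition ceil_div :: "nat \<Rightarrow> nat \<Rightarrow> nat" where
  "ceil_div n w = (n + w - 1) div w"

text \<open>The adjunction defining the ceiling; it converts a lower bound on the value into one on
  the order of vanishing.\<close>

lemma ceil_div_le_iff: "w > 0 \<Longrightarrow> ceil_div n w \<le> k \<longleftrightarrow> n \<le> w * k"
proof -
  assume w: "w > 0"
  have "ceil_div n w \<le> k \<longleftrightarrow> (n + w - 1) div w < Suc k" by (simp add: ceil_div_def less_Suc_eq_le)
  also have "\<dots> \<longleftrightarrow> n + w - 1 < Suc k * w" by (rule div_less_iff_less_mult[OF w])
  also have "\<dots> \<longleftrightarrow> n \<le> w * k" using w by (auto simp: algebra_simps)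
  finally show ?thesis .
qed

lemma ceil_div_mono: "n \<le> n' \<Longrightarrow> ceil_div n w \<le> ceil_div n' w"
  unfolding ceil_div_def by (rule div_le_mono) simp

lemma ceil_div_bounds:
  assumes "w > 0"
  shows "real n / real w \<le> real (ceil_div n w)"
    and "real (ceil_div n w) \<le> real n / real w + 1"
proof -
  have "n \<le> w * ceil_div n w" using ceil_div_le_iff[OF assms, of n] by blast
  then have "real n \<le> real w * real (ceil_div n w)" by (metis of_nat_le_iff of_nat_mult)
  then show "real n / real w \<le> real (ceil_div n w)" using assms by (simp add: field_simps)
  have "ceil_div n w * w \<le> n + w"
    using div_times_less_eq_dividend[of "n + w - 1" w] unfolding ceil_div_def by linarith
  then have "real (ceil_div n w) * real w \<le> real n + real w"
    by (metis of_nat_le_iff of_nat_mult of_nat_add)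
  then show "real (ceil_div n w) \<le> real n / real w + 1" using assms by (simp add: field_simps)
qed

text \<open>Each valuation demands, in degree d < m, vanishing at its point to order at least (m -
  d) / w. As the points are distinct, the demands combine into divisibility by one product.\<close>

lemma mono_fil_eq_hideal:
  assumes V: "\<forall>(c, w)\<in>V. w > 0" and fin: "finite V" and inj: "inj_on fst V"
  shows "mono_fil V (real m) = hideal m (\<lambda>d. \<Prod>v\<in>V. [:- fst v, 1:] ^ ceil_div (m - d) (snd v))"
proof -
  have "f \<in> mono_fil V (real m) \<longleftrightarrow>
    (\<forall>d<m. (\<Prod>v\<in>V. [:- fst v, 1:] ^ ceil_div (m - d) (snd v)) dvd hpoly d f)" (is "_ \<longleftrightarrow> ?R") for f
  proof -
    have *: "[:- fst v, 1:] ^ ceil_div (m - d) (snd v) dvd hpoly d f \<longleftrightarrow>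
        (hpoly d f \<noteq> 0 \<longrightarrow> real m \<le> real (d + snd v * order (fst v) (hpoly d f)))" if "v \<in> V" for v d
    proof -
      have "snd v > 0" using V that by auto
      then show ?thesis
        unfolding order_divides of_nat_le_iff by (auto simp: ceil_div_le_iff)
    qed
    have "f \<in> mono_fil V (real m) \<longleftrightarrow>
        (\<forall>v\<in>V. \<forall>d. hpoly d f \<noteq> 0 \<longrightarrow> real m \<le> real (d + snd v * order (fst v) (hpoly d f)))"
      unfolding mem_mono_fil_hpoly_iff[OF V] by (intro ball_cong refl) (simp only: split_beta)
    \<comment> \<open>Parts of degree at least \<open>m\<close> meet the bound through their degree
      alone.\<close>
    also have "\<dots> \<longleftrightarrow>
        (\<forall>v\<in>V. \<forall>d<m. hpoly d f \<noteq> 0 \<longrightarrow> real m \<le> real (d + snd v * order (fst v) (hpoly d f)))"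
      unfolding of_nat_le_iff by (meson not_le trans_le_add1)
    also have "\<dots> \<longleftrightarrow> (\<forall>d<m. \<forall>v\<in>V. [:- fst v, 1:] ^ ceil_div (m - d) (snd v) dvd hpoly d f)"
      using * by blast
    also have "\<dots> \<longleftrightarrow> ?R"
    proof -
      have "(\<forall>v\<in>V. [:- fst v, 1:] ^ ceil_div (m - d) (snd v) dvd hpoly d f) \<longleftrightarrow>
          (\<Prod>v\<in>V. [:- fst v, 1:] ^ ceil_div (m - d) (snd v)) dvd hpoly d f" for d
      proof
        assume "\<forall>v\<in>V. [:- fst v, 1:] ^ ceil_div (m - d) (snd v) dvd hpoly d f"
        then show "(\<Prod>v\<in>V. [:- fst v, 1:] ^ ceil_div (m - d) (snd v)) dvd hpoly d f"
          by (intro prod_linear_powers_dvd[OF fin inj]) blast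
      next
        assume R: "(\<Prod>v\<in>V. [:- fst v, 1:] ^ ceil_div (m - d) (snd v)) dvd hpoly d f"
        show "\<forall>v\<in>V. [:- fst v, 1:] ^ ceil_div (m - d) (snd v) dvd hpoly d f"
        proof
          fix v assume "v \<in> V"
          from dvd_prodI[OF fin this] R
          show "[:- fst v, 1:] ^ ceil_div (m - d) (snd v) dvd hpoly d f" by (rule dvd_trans)
        qed
      qed
      then show ?thesis by blast
    qed
    finally show ?thesis .
  qed
  then show ?thesis unfolding hideal_def by blast
qed

lemma length_mono_fil:
  assumes V: "\<forall>(c, w)\<in>V. w > 0" and fin: "finite V" and inj: "inj_on fst V"
  shows "module_length Rxy (quot_module Rxy (mono_fil V (real m))) =
    enat (\<Sum>d<m. min (Suc d) (\<Sum>v\<in>V. ceil_div (m - d) (snd v)))"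
proof -
  let ?Q = "\<lambda>d. \<Prod>v\<in>V. [:- fst v, 1:] ^ ceil_div (m - d) (snd v)"
  have "?Q e dvd ?Q d" if "d \<le> e" for d e
    by (intro prod_dvd_prod le_imp_power_dvd ceil_div_mono) (use that in simp)
  moreover have "?Q d \<noteq> 0" for d using fin by simp
  ultimately show ?thesis
    unfolding mono_fil_eq_hideal[OF assms]
    by (subst module_length_hideal) (simp_all only: degree_prod_linear_powers not_False_eq_True)
qed

text \<open>The two linear functions of d cross at d = \<sigma> m with \<sigma> = s / (1 + s). The
  triangles on either side of the crossing give, after normalization, \<sigma>^2 + s (1 -
  \<sigma>)^2 = s / (1 + s).\<close>

lemma sum_min_linear_asymptotics:
  fixes s :: real
  assumes s: "s \<ge> 0"
  shows "(\<lambda>m. (\<Sum>d<m. min (real d) (s * real (m - d))) / (real m ^ 2 / 2)) \<longlonglongrightarrow> s / (1 + s)"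
proof -
  define \<sigma> where "\<sigma> = s / (1 + s)"
  have \<sigma>: "0 \<le> \<sigma>" "\<sigma> < 1" using s by (auto simp: \<sigma>_def field_simps)
  \<comment> \<open>The last index at which the increasing function is still the minimum.\<close>
  define K where "K m = nat \<lfloor>\<sigma> * real m\<rfloor>" for m
  have K: "real (K m) \<le> \<sigma> * real m" "\<sigma> * real m < real (K m) + 1" for m
    using \<sigma> by (auto simp: K_def of_nat_nat)
  have Klt: "K m < m" if "m > 0" for m
  proof -
    have "\<sigma> * real m < 1 * real m" using \<sigma>(2) that by (intro mult_strict_right_mono) auto
    then have "real (K m) < real m" using K(1)[of m] by linarith
    then show ?thesis by simp
  qed
  have cmp: "real d \<le> s * real (m - d) \<longleftrightarrow> real d \<le> \<sigma> * real m" if "d < m" for d m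
    using that s by (simp add: \<sigma>_def field_simps of_nat_diff)
  have sum: "(\<Sum>d<m. min (real d) (s * real (m - d))) =
      real (K m) * (real (K m) + 1) / 2 + s * (real m - real (K m) - 1) * (real m - real (K m)) / 2"
    if m: "m > 0" for m
  proof -
    have "(\<Sum>d<m. min (real d) (s * real (m - d))) =
        (\<Sum>d<Suc (K m). min (real d) (s * real (m - d))) + (\<Sum>d=Suc (K m)..<m. min (real d) (s * real (m - d)))"
      using Klt[OF m] by (simp only: lessThan_atLeast0 sum.atLeastLessThan_concat Suc_leI)
    also have "(\<Sum>d<Suc (K m). min (real d) (s * real (m - d))) = (\<Sum>d<Suc (K m). real d)"
    proof (rule sum.cong[OF refl])
      fix d assume "d \<in> {..<Suc (K m)}"
      then have "real d \<le> \<sigma> * real m" "d < m" using K(1)[of m] Klt[OF m] by auto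
      then show "min (real d) (s * real (m - d)) = real d" using cmp by (simp add: min_def)
    qed
    also have "(\<Sum>d<Suc n. real d) = real n * (real n + 1) / 2" for n
      by (induction n) (simp_all add: field_simps)
    also have "(\<Sum>d=Suc (K m)..<m. min (real d) (s * real (m - d))) = (\<Sum>d=Suc (K m)..<m. s * real (m - d))"
    proof (rule sum.cong[OF refl])
      fix d assume d: "d \<in> {Suc (K m)..<m}"
      then have "\<not> real d \<le> \<sigma> * real m" using K(2)[of m] by auto
      then show "min (real d) (s * real (m - d)) = s * real (m - d)" using cmp[of d m] d by (simp add: min_def)
    qed
    also have "\<dots> = s * (\<Sum>d=Suc (K m)..<m. real (m - d))" by (simp add: sum_distrib_left)
    also have "(\<Sum>d=Suc (K m)..<m. real (m - d)) = (\<Sum>j\<in>{1..<m - K m}. real j)"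
      by (rule sum.reindex_bij_witness[where i = "\<lambda>j. m - j" and j = "\<lambda>d. m - d"]) auto
    also have "\<dots> = (real (m - K m) - 1) * real (m - K m) / 2"
    proof -
      have "(\<Sum>j\<in>{1..<n}. real j) = (real n - 1) * real n / 2" if "n > 0" for n
        using that by (induction n rule: nat_induct_non_zero) (simp_all add: field_simps)
      then show ?thesis using Klt[OF m] by simp
    qed
    finally show ?thesis using Klt[OF m] by (simp add: of_nat_diff algebra_simps)
  qed
  have inv0: "(\<lambda>m. 1 / real m) \<longlonglongrightarrow> 0" by (rule lim_1_over_n)
  have Klim: "(\<lambda>m. real (K m) / real m) \<longlonglongrightarrow> \<sigma>"
  proof (rule tendsto_sandwich)
    show "\<forall>\<^sub>F m in sequentially. \<sigma> - 1 / real m \<le> real (K m) / real m"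
      using eventually_gt_at_top[of 0] by eventually_elim (use K(2) in \<open>simp add: field_simps less_imp_le\<close>)
    show "\<forall>\<^sub>F m in sequentially. real (K m) / real m \<le> \<sigma>"
      using eventually_gt_at_top[of 0] by eventually_elim (use K(1) in \<open>simp add: field_simps\<close>)
    show "(\<lambda>m. \<sigma> - 1 / real m) \<longlonglongrightarrow> \<sigma>" using tendsto_diff[OF tendsto_const inv0] by simp
  qed simp
  let ?k = "\<lambda>m. real (K m) / real m"
  \<comment> \<open>The closed form divided by m^2 / 2, written through the ratio K / m, which tends
    to \<sigma>.\<close>
  have "(\<lambda>m. ?k m * (?k m + 1 / real m) + s * (1 - ?k m - 1 / real m) * (1 - ?k m))
      \<longlonglongrightarrow> \<sigma> * (\<sigma> + 0) + s * (1 - \<sigma> - 0) * (1 - \<sigma>)"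
    by (intro tendsto_intros Klim inv0)
  also have "\<sigma> * (\<sigma> + 0) + s * (1 - \<sigma> - 0) * (1 - \<sigma>) = s / (1 + s)"
  proof -
    have 1: "1 - \<sigma> = 1 / (1 + s)" using s by (simp add: \<sigma>_def field_simps)
    show ?thesis unfolding diff_0_right add_0_right 1 unfolding \<sigma>_def using s
      by (simp add: divide_simps) (simp add: algebra_simps)
  qed
  finally show ?thesis
  proof (rule Lim_transform_eventually)
    show "\<forall>\<^sub>F m in sequentially. ?k m * (?k m + 1 / real m) + s * (1 - ?k m - 1 / real m) * (1 - ?k m) =
        (\<Sum>d<m. min (real d) (s * real (m - d))) / (real m ^ 2 / 2)"
      using eventually_gt_at_top[of 0]
    proof eventually_elim
      case (elim m)
      then show ?case unfolding sum[OF elim] by (simp add: field_simps power2_eq_square)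
    qed
  qed
qed

text \<open>Rounding changes the colength only by a term linear in m, which disappears after
  division by m^2 / 2.\<close>

lemma multiplicity_mono_fil:
  assumes V: "\<forall>(c, w)\<in>V. w > 0" and fin: "finite V" and inj: "inj_on fst V"
  defines "s \<equiv> \<Sum>v\<in>V. 1 / real (snd v)"
  shows "multiplicity_fil 2 Rxy (mono_fil V) = s / (1 + s)"
proof -
  let ?G = "\<lambda>m. \<Sum>d<m. min (real d) (s * real (m - d))"
  let ?D = "\<lambda>m d. \<Sum>v\<in>V. ceil_div (m - d) (snd v)"
  let ?L = "\<lambda>m. \<Sum>d<m. min (Suc d) (?D m d)"
  \<comment> \<open>The error per degree: at most 1 for each rounded quotient, and 1 for replacing d
    + 1 by d.\<close>
  let ?B = "real (card V) + 1"
  have s0: "s \<ge> 0" unfolding s_def by (intro sum_nonneg) simp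
  have pos: "snd v > 0" if "v \<in> V" for v using V that by auto
  have eq: "s * real n = (\<Sum>v\<in>V. real n / real (snd v))" for n
    by (simp add: s_def sum_distrib_right)
  have lo: "s * real (m - d) \<le> real (?D m d)" for m d
    unfolding eq of_nat_sum by (intro sum_mono ceil_div_bounds pos)
  have hi: "real (?D m d) \<le> s * real (m - d) + real (card V)" for m d
  proof -
    have "real (?D m d) \<le> (\<Sum>v\<in>V. real (m - d) / real (snd v) + 1)"
      unfolding of_nat_sum by (intro sum_mono ceil_div_bounds pos)
    then show ?thesis by (simp add: eq sum.distrib)
  qed
  have lower: "?G m \<le> real (?L m)" for m
    unfolding of_nat_sum
  proof (rule sum_mono)
    fix d show "min (real d) (s * real (m - d)) \<le> real (min (Suc d) (?D m d))"
      unfolding of_nat_min using lo[of m d] by (simp add: min_le_iff_disj min_def)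
  qed
  have upper: "real (?L m) \<le> ?G m + ?B * real m" for m
  proof -
    have "real (?L m) \<le> (\<Sum>d<m. min (real d) (s * real (m - d)) + ?B)"
      unfolding of_nat_sum
    proof (rule sum_mono)
      fix d show "real (min (Suc d) (?D m d)) \<le> min (real d) (s * real (m - d)) + ?B"
        unfolding of_nat_min of_nat_Suc using hi[of m d] by (simp only: min_def split: if_split) linarith
    qed
    then show ?thesis by (simp add: sum.distrib mult.commute)
  qed
  note Glim = sum_min_linear_asymptotics[OF s0]
  have "(\<lambda>m. real (?L m) / (real m ^ 2 / 2)) \<longlonglongrightarrow> s / (1 + s)"
  proof (rule tendsto_sandwich[OF _ _ Glim])
    show "\<forall>\<^sub>F m in sequentially. ?G m / (real m ^ 2 / 2) \<le> real (?L m) / (real m ^ 2 / 2)"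
      using lower by (intro always_eventually allI divide_right_mono) auto
    show "\<forall>\<^sub>F m in sequentially. real (?L m) / (real m ^ 2 / 2) \<le>
        ?G m / (real m ^ 2 / 2) + 2 * ?B * (1 / real m)"
      using eventually_gt_at_top[of 0]
    proof eventually_elim
      case (elim m)
      have "real (?L m) / (real m ^ 2 / 2) \<le> (?G m + ?B * real m) / (real m ^ 2 / 2)"
        using upper[of m] by (intro divide_right_mono) auto
      also have "\<dots> = ?G m / (real m ^ 2 / 2) + 2 * ?B * (1 / real m)"
        unfolding add_divide_distrib using elim by (simp add: power2_eq_square field_simps)
      finally show ?case .
    qed
    show "(\<lambda>m. ?G m / (real m ^ 2 / 2) + 2 * ?B * (1 / real m)) \<longlonglongrightarrow> s / (1 + s)"
      using tendsto_add[OF Glim tendsto_mult[OF tendsto_const[of "2 * ?B"] lim_1_over_n]] by simp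
  qed
  then show ?thesis
    unfolding multiplicity_fil_def length_mono_fil[OF V fin inj] by (simp add: fact_2 limI)
qed

text \<open>For d < m the part of degree d must vanish at infinitely many points and is therefore
  zero. The step at m consists of the series of order at least m, of colength m (m + 1) / 2.\<close>

lemma multiplicity_mono_fil_infinite:
  assumes V: "\<forall>(c, w)\<in>V. w > 0" and inf: "infinite (fst ` V)"
  shows "multiplicity_fil 2 Rxy (mono_fil V) = 1"
proof -
  \<comment> \<open>The divisor \<open>monom 1 m\<close> encodes vanishing: its degree m exceeds
    every d < m, so it divides only the zero part.\<close>
  have "mono_fil V (real m) = hideal m (\<lambda>d. monom 1 m)" for m
  proof -
    have "f \<in> mono_fil V (real m) \<longleftrightarrow> (\<forall>d<m. hpoly d f = 0)" for f
    proof
      assume f: "f \<in> mono_fil V (real m)"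
      show "\<forall>d<m. hpoly d f = 0"
      proof (intro allI impI, rule ccontr)
        fix d assume d: "d < m" and nz: "hpoly d f \<noteq> 0"
        have "fst ` V \<subseteq> {c. poly (hpoly d f) c = 0}"
        proof clarsimp
          fix c w assume "(c, w) \<in> V"
          then have "real m \<le> real (d + w * order c (hpoly d f))"
            using f nz by (auto simp: mem_mono_fil_hpoly_iff[OF V])
          then have "order c (hpoly d f) \<noteq> 0" using d by (intro notI) simp
          then show "poly (hpoly d f) c = 0" using order_root by blast
        qed
        then show False using inf poly_roots_finite[OF nz] finite_subset by blast
      qed
    next
      assume z: "\<forall>d<m. hpoly d f = 0"
      then have "m \<le> d" if "hpoly d f \<noteq> 0" for d using that not_le by blast
      then show "f \<in> mono_fil V (real m)"
        by (auto simp: mem_mono_fil_hpoly_iff[OF V] simp del: of_nat_add of_nat_mult intro: trans_le_add1)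
    qed
    moreover have "monom 1 m dvd hpoly d f \<longleftrightarrow> hpoly d f = 0" if "d < m" for d f
      using dvd_imp_degree_le[of "monom 1 m" "hpoly d f"] degree_hpoly[of d f] that
      by (auto simp: degree_monom_eq)
    ultimately show ?thesis by (auto simp: hideal_def)
  qed
  moreover have "module_length Rxy (quot_module Rxy (hideal m (\<lambda>d. monom 1 m))) = enat (m * (m + 1) div 2)" for m
  proof -
    have "(\<Sum>d<m. min (Suc d) (degree (monom (1::complex) m))) = (\<Sum>d<m. Suc d)"
      by (rule sum.cong) (auto simp: degree_monom_eq)
    also have "\<dots> = m * (m + 1) div 2" by (induction m) auto
    finally show ?thesis by (subst module_length_hideal) (auto simp: monom_eq_0_iff)
  qed
  moreover have "(\<lambda>m. real (m * (m + 1) div 2) / (real m ^ 2 / 2)) \<longlonglongrightarrow> 1"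
  proof (rule Lim_transform_eventually)
    show "(\<lambda>m. 1 + 1 / real m) \<longlonglongrightarrow> 1" using tendsto_add[OF tendsto_const lim_1_over_n] by simp
    show "\<forall>\<^sub>F m in sequentially. 1 + 1 / real m = real (m * (m + 1) div 2) / (real m ^ 2 / 2)"
      using eventually_gt_at_top[of 0]
    proof eventually_elim
      case (elim m)
      have "real (m * (m + 1) div 2) = real m * (real m + 1) / 2"
        by (subst real_of_nat_div) (auto simp: algebra_simps)
      then show ?case using elim by (simp add: power2_eq_square field_simps)
    qed
  qed
  ultimately show ?thesis
    unfolding multiplicity_fil_def by (simp add: fact_2 limI)
qed

text \<open>Each valuation used has positive volume: its multiplicity is that of a singleton family,
  namely 1 / (1 + w).\<close>

lemma mono_fil_in_Fil_sat:
  assumes V: "\<forall>(c, w)\<in>V. w > 0" "V \<noteq> {}"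
  shows "mono_fil V \<in> Fil_sat 2 mxy"
proof -
  have "positive_volume 2 (mono_val c w)" if "w > 0" for c w
  proof -
    have "valuation_fil (mono_val c w) = mono_fil {(c, w)}"
      by (simp add: mono_fil_def Inter_fil_def)
    moreover have "multiplicity_fil 2 Rxy (mono_fil {(c, w)}) = (1 / real w) / (1 + 1 / real w)"
      using that multiplicity_mono_fil[of "{(c, w)}"] by simp
    moreover have "(1 / real w) / (1 + 1 / real w) > 0"
      using that by (intro divide_pos_pos add_pos_pos) auto
    ultimately show ?thesis by (simp add: positive_volume_def)
  qed
  then have "\<forall>v\<in>(\<lambda>(c, w). mono_val c w) ` V. real_valuation v \<and> centered_at mxy v \<and> positive_volume 2 v"
    using V real_valuation_mono_val centered_at_mono_val by auto
  moreover have "(\<lambda>(c, w). mono_val c w) ` V \<noteq> {}" using V by simp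
  ultimately have "saturated 2 mxy (mono_fil V)"
    unfolding saturated_def mono_fil_def
    by (intro exI[of _ "(\<lambda>(c, w). mono_val c w) ` V"] conjI) simp_all
  then show ?thesis using mono_fil_in_Fil[OF V] by (simp add: Fil_sat_def)
qed

section \<open>The decreasing sequence, its intersection and the limit of the distances\<close>

theorem theorem1p2:
  shows "(\<exists>\<aa> :: nat \<Rightarrow> cxy filtration.
            decreasing_sat_seq \<aa> \<and>
            (\<lambda>k. d1 2 Rxy (Inter_fil {1..} \<aa>) (\<aa> k)) \<longlonglongrightarrow> 1 / 2)
       \<and> \<not> (\<forall>\<aa> :: nat \<Rightarrow> cxy filtration.
            decreasing_sat_seq \<aa> \<longrightarrow>
            (\<lambda>k. d1 2 Rxy (Inter_fil {1..} \<aa>) (\<aa> k)) \<longlonglongrightarrow> 0)"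
proof -
  \<comment> \<open>The points are distinct, and the reciprocal weights sum to 1 over all i \<ge> 1.
    The multiplicities s / (1 + s) therefore stay below 1/2, while infinitely many points force
    multiplicity 1 on the intersection.\<close>
  define u :: "nat \<Rightarrow> complex \<times> nat" where "u i = (of_nat i, 2 ^ i)" for i
  define \<aa> where "\<aa> k = mono_fil (u ` {1..k})" for k
  have u: "\<forall>(c, w)\<in>u ` A. w > 0" for A by (auto simp: u_def)
  have inj: "inj_on fst (u ` A)" "inj_on u A" for A by (auto simp: inj_on_def u_def)
  have Inter: "Inter_fil {1..} \<aa> = mono_fil (u ` {1..})"
  proof
    fix s
    have "f \<in> Inter_fil {1..} \<aa> s \<longleftrightarrow> f \<in> mono_fil (u ` {1..}) s" for f
    proof -
      have "f \<in> Inter_fil {1..} \<aa> s \<longleftrightarrow> (\<forall>k\<ge>1. f \<in> mono_fil (u ` {1..k}) s)"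
        by (auto simp: Inter_fil_def \<aa>_def)
      also have "\<dots> \<longleftrightarrow> f \<in> mono_fil (u ` {1..}) s"
        unfolding mem_mono_fil_iff[OF u] by (fastforce simp: u_def)
      finally show ?thesis .
    qed
    then show "Inter_fil {1..} \<aa> s = mono_fil (u ` {1..}) s" by blast
  qed
  have dec: "\<aa> (Suc k) s \<subseteq> \<aa> k s" for k s
  proof
    fix f assume "f \<in> \<aa> (Suc k) s"
    then show "f \<in> \<aa> k s"
      unfolding \<aa>_def mem_mono_fil_iff[OF u] by (fastforce simp: u_def)
  qed
  have seq: "decreasing_sat_seq \<aa>"
    unfolding decreasing_sat_seq_def Inter using dec
    by (auto simp: \<aa>_def intro!: mono_fil_in_Fil_sat u)
  have "infinite (fst ` u ` {1..})"
  proof -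
    have "fst ` u ` {1..} = (of_nat :: nat \<Rightarrow> complex) ` {1..}" by (simp add: image_image u_def)
    then show ?thesis by (simp add: finite_image_iff inj_on_def infinite_Ici)
  qed
  then have e: "multiplicity_fil 2 Rxy (Inter_fil {1..} \<aa>) = 1"
    unfolding Inter by (rule multiplicity_mono_fil_infinite[OF u])
  have ek: "multiplicity_fil 2 Rxy (\<aa> k) = (1 - (1 / 2) ^ k) / (2 - (1 / 2) ^ k)" for k
  proof -
    have "(\<Sum>v\<in>u ` {1..k}. 1 / real (snd v)) = (\<Sum>i=1..k. (1 / 2) ^ i)"
      using inj(2) by (subst sum.reindex) (auto simp: u_def power_one_over)
    also have "\<dots> = 1 - (1 / 2) ^ k" by (induction k) auto
    finally show ?thesis
      unfolding \<aa>_def using multiplicity_mono_fil[OF u _ inj(1), of "{1..k}"] by simp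
  qed
  have "d1 2 Rxy (Inter_fil {1..} \<aa>) (\<aa> k) = 1 - (1 - (1 / 2) ^ k) / (2 - (1 / 2) ^ k)" if "k \<ge> 1" for k
  proof -
    \<comment> \<open>The total intersection lies inside each member, so the distance reduces to a
      difference of multiplicities.\<close>
    have "inter_fil (Inter_fil {1..} \<aa>) (\<aa> k) = Inter_fil {1..} \<aa>"
      using that by (auto simp: inter_fil_def Inter_fil_def)
    then show ?thesis unfolding d1_def by (simp only: e ek)
  qed
  moreover have "(\<lambda>k. 1 - (1 - (1 / 2) ^ k) / (2 - (1 / 2) ^ k)) \<longlonglongrightarrow> 1 - (1 - 0) / (2 - (0::real))"
    by (intro tendsto_intros LIMSEQ_power_zero) auto
  ultimately have lim: "(\<lambda>k. d1 2 Rxy (Inter_fil {1..} \<aa>) (\<aa> k)) \<longlonglongrightarrow> 1 / 2"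
    by (subst tendsto_cong[where g = "\<lambda>k. 1 - (1 - (1 / 2) ^ k) / (2 - (1 / 2) ^ k)"])
      (auto intro: eventually_sequentiallyI[of 1])
  \<comment> \<open>The same sequence refutes monotone convergence, by uniqueness of limits.\<close>
  then have "\<not> (\<lambda>k. d1 2 Rxy (Inter_fil {1..} \<aa>) (\<aa> k)) \<longlonglongrightarrow> 0"
    using LIMSEQ_unique by fastforce
  then show ?thesis using seq lim by blast
qed

end
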